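(* For every positive integer $t$, as power series in $q$, \[ F_t(x;q)=\begin{cases}(-q^2;q^2)_\infty\left((1-x^2)q^{2t};q^{2t}\right)_\infty^{\frac{t-1}{2}}D^*(x;q^t) & \text{if } t \text{ is odd},\\[4pt] (-q^2;q^2)_\infty\left((1-x^2)q^{2t};q^{2t}\right)_\infty^{\frac{t-2}{2}}D^*(x;q^t)\,H^*(x;q^t) & \text{if } t\text{ is even},\end{cases} \] where $F_t(x;q)=\sum_{\lambda\lambda\in\mathcal{DD}}x^{n_t(\lambda\lambda)}q^{|\lambda\lambda|}$ and \[ D^*(x;q)=\frac{1}{1+x}\Big(\left((1-x^2)q^2;q^4\right)_\infty+x\left((1-x^2)q^4;q^4\right)_\infty\Big), \] \[ H^*(x;q)=\frac{1}{2x}\left[\left(1-\sqrt{\tfrac{1-x}{1+x}}\right)\left(-\sqrt{1-x^2};-q\right)_\infty+\left(1+\sqrt{\tfrac{1-x}{1+x}}\right)\left(\sqrt{1-x^2};-q\right)_\infty\right]. \]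
   Context: Notation: $(a;q)_\infty=\prod_{k\ge1}(1-aq^{k-1})$. The two square roots in $H^*$ are chosen compatibly, i.e. $\sqrt{1-x^2}=(1+x)\sqrt{(1-x)/(1+x)}$ (e.g. both nonnegative for $0<x<1$); $H^*$ does not depend on this choice. A partition is a finite weakly decreasing sequence of positive integers (the empty partition included); $|\lambda|$ is the sum of its parts. The box $(i,j)$ is the box in row $i$, column $j$ of the Young diagram. The hook of a box consists of the box itself and all boxes to its right in the same row or below it in the same column; the hook length is the number of boxes in the hook; a $t$-hook is a hook of length $t$. $n_t(\lambda)$ denotes the number of $t$-hooks of $\lambda$. A strict partition is a partition into distinct parts. For a strict partition $\lambda=(\lambda_1>\dots>\lambda_\ell)$, the doubled distinct partition $\lambda\lambda$ is obtained from the shifted Young diagram of $\lambda$ (row $i$ moved right by $i-1$ boxes) by adding $\lambda_i$ boxes to the $(i-1)$-st column for each $i$; equivalently, $\lambda\lambda$ is the partition of $2|\lambda|$ with Frobenius symbol $\begin{pmatrix}\lambda_1&\cdots&\lambda_\ell\\ \lambda_1-1&\cdots&\lambda_\ell-1\end{pmatrix}$ (the Frobenius symbol of $\mu$ with Durfee square of side $s$ has top row $\mu_i-i$ and bottom row $\mu'_i-i$, $1\le i\le s$, where $\mu'$ is the conjugate partition). E.g. $\lambda=(5,4,1)$ gives $\lambda\lambda=(6,6,4,2,2)$. $\mathcal{DD}$ is the set of all doubled distinct partitions (including the empty one). *)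

theory Defs
  imports "HOL-Analysis.Analysis"
begin

section \<open>Partitions, Young diagrams and hooks\<close>

definition is_partition :: "nat list \<Rightarrow> bool" where
  "is_partition mu \<longleftrightarrow> sorted_wrt (\<ge>) mu \<and> (\<forall>p \<in> set mu. p > 0)"

definition is_strict_partition :: "nat list \<Rightarrow> bool" where
  "is_strict_partition la \<longleftrightarrow> sorted_wrt (>) la \<and> (\<forall>p \<in> set la. p > 0)"

text \<open>Boxes are pairs (row, column), both numbered from 0.\<close>

definition young :: "nat list \<Rightarrow> (nat \<times> nat) set" where
  "young mu = {(i, j). i < length mu \<and> j < mu ! i}"

definition hook :: "nat list \<Rightarrow> nat \<times> nat \<Rightarrow> (nat \<times> nat) set" where
  "hook mu b = {(i, j) \<in> young mu. (i = fst b \<and> j \<ge> snd b) \<or> (j = snd b \<and> i \<ge> fst b)}"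

definition num_hooks :: "nat \<Rightarrow> nat list \<Rightarrow> nat" where
  "num_hooks t mu = card {b \<in> young mu. card (hook mu b) = t}"

section \<open>Doubled distinct partitions\<close>

text \<open>With rows numbered from 0, the columns are shifted by one so that the leftmost added
  column is column 0: row \<open>i\<close> of the shifted diagram then occupies the columns
  \<open>i + 1, \<dots>, i + la ! i\<close>, and the \<open>la ! j\<close> boxes added to column \<open>j\<close>
  occupy the rows \<open>j, \<dots>, j + la ! j - 1\<close>.\<close>

definition shifted_diagram :: "nat list \<Rightarrow> (nat \<times> nat) set" where
  "shifted_diagram la = {(i, j). i < length la \<and> i < j \<and> j \<le> i + la ! i}"

definition added_boxes :: "nat list \<Rightarrow> (nat \<times> nat) set" where
  "added_boxes la = {(i, j). j < length la \<and> j \<le> i \<and> i < j + la ! j}"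

definition is_doubled :: "nat list \<Rightarrow> nat list \<Rightarrow> bool" where
  "is_doubled la mu \<longleftrightarrow>
     is_partition mu \<and> young mu = shifted_diagram la \<union> added_boxes la"

definition DD :: "nat list set" where
  "DD = {mu. \<exists>la. is_strict_partition la \<and> is_doubled la mu}"

lemma is_doubled_example: "is_doubled [5, 4, 1] [6, 6, 4, 2, 2]"
proof -
  have "young [6, 6, 4, 2, 2] = shifted_diagram [5, 4, 1] \<union> added_boxes [5, 4, 1]"
    unfolding young_def shifted_diagram_def added_boxes_def
    by (auto simp: less_Suc_eq nth_Cons' numeral_eq_Suc split: if_splits)
  then show ?thesis
    by (simp add: is_doubled_def is_partition_def)
qed

text \<open>The coefficients of \<open>F_series\<close> below are sums over finite sets.\<close>

lemma finite_DD_of_size: "finite {mu \<in> DD. sum_list mu = n}"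
proof (rule finite_subset)
  show "{mu \<in> DD. sum_list mu = n} \<subseteq> {mu. set mu \<subseteq> {..n} \<and> length mu \<le> n}"
  proof (intro subsetI CollectI conjI)
    fix mu p assume "mu \<in> {mu \<in> DD. sum_list mu = n}" "p \<in> set mu"
    then show "p \<in> {..n}" using member_le_sum_list by auto
  next
    fix mu assume mu: "mu \<in> {mu \<in> DD. sum_list mu = n}"
    then have pos: "\<forall>p \<in> set mu. 0 < p"
      by (auto simp: DD_def is_doubled_def is_partition_def)
    have "length xs \<le> sum_list xs" if "\<forall>p \<in> set xs. 0 < p" for xs :: "nat list"
      using that by (induction xs) auto
    with pos mu show "length mu \<le> n" by auto
  qed
  show "finite {mu. set mu \<subseteq> {..n} \<and> length mu \<le> n}"
    by (rule finite_lists_length_le) simp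
qed

section \<open>The power series\<close>

text \<open>The sum of \<open>x ^ num_hooks t mu * q ^ sum_list mu\<close> over \<open>mu \<in> DD\<close>, as a formal power
  series in \<open>q\<close>.\<close>

definition F_series :: "nat \<Rightarrow> 'a::field_char_0 \<Rightarrow> 'a fps" where
  "F_series t x = Abs_fps (\<lambda>n. \<Sum>mu \<in> {mu \<in> DD. sum_list mu = n}. x ^ num_hooks t mu)"

text \<open>The infinite product is taken in the standard topology of formal power series.
  The arguments are power series; \<open>fps_X\<close> is the variable \<open>q\<close>, and replacing \<open>q\<close> by
  \<open>q ^ t\<close> amounts to passing \<open>fps_X ^ t\<close>.\<close>

definition qpoch_inf :: "'a::field_char_0 fps \<Rightarrow> 'a fps \<Rightarrow> 'a fps" where
  "qpoch_inf a q = (\<Prod>k. 1 - a * q ^ k)"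

definition D_star :: "'a::field_char_0 \<Rightarrow> 'a fps \<Rightarrow> 'a fps" where
  "D_star x q = fps_const (1 / (1 + x)) *
     (qpoch_inf (fps_const (1 - x^2) * q^2) (q^4)
      + fps_const x * qpoch_inf (fps_const (1 - x^2) * q^4) (q^4))"

text \<open>The arguments \<open>r\<close> and \<open>s\<close> stand for the chosen square roots of
  \<open>(1 - x) / (1 + x)\<close> and \<open>1 - x^2\<close>.\<close>

definition H_star :: "'a::field_char_0 \<Rightarrow> 'a \<Rightarrow> 'a \<Rightarrow> 'a fps \<Rightarrow> 'a fps" where
  "H_star x r s q = fps_const (1 / (2 * x)) *
     (fps_const (1 - r) * qpoch_inf (fps_const (- s)) (- q)
      + fps_const (1 + r) * qpoch_inf (fps_const s) (- q))"

definition compatible_roots :: "'a::field_char_0 \<Rightarrow> 'a \<Rightarrow> 'a \<Rightarrow> bool" where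
  "compatible_roots x r s \<longleftrightarrow>
     r^2 = (1 - x) / (1 + x) \<and> s^2 = 1 - x^2 \<and> s = (1 + x) * r"

end

theory Submission
  imports Defs
begin

text \<open>
  The bead set of the doubled distinct partition of a strict partition with set of parts \<open>S\<close> is
  \<open>S \<union> {- n | n \<ge> 1, n \<notin> S}\<close>, and its \<open>t\<close>-hooks are the beads \<open>a\<close> such that \<open>a - t\<close> is not a
  bead. Both this count and the size \<open>2 * \<Sum>S\<close> split over the classes \<open>{r, t - r}\<close> of residues
  modulo \<open>t\<close>, so \<open>F_series t x\<close> is a product with one factor for each class.

  A factor is a sum over binary words of \<open>(x ^ 2) ^ k\<close> times a geometric weight, where \<open>k\<close> is the
  number of runs. Marking runs by powers of \<open>- a\<close>, \<open>a = 1 - x ^ 2\<close>, turns it into a sum over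
  placements of dominoes, which has a closed form in Gaussian binomial coefficients. With
  \<open>Q = q ^ (2 * t)\<close>, a class with \<open>0 < r < t / 2\<close> consists of two-sided infinite words and contributes
  \<open>(a Q; Q) (- q ^ (2 * r); Q) (- q ^ (2 * (t - r)); Q)\<close> by Euler's expansion of an infinite
  product. The classes \<open>0\<close> and \<open>t / 2\<close> consist of one-sided words in which a run starting at the
  first position has weight \<open>x\<close> instead of \<open>x ^ 2\<close>; they contribute \<open>(- Q; Q) D_star\<close> and
  \<open>(- q ^ t; Q) H_star\<close>, again by Euler's expansion. The remaining factors combine to
  \<open>(- q ^ 2; q ^ 2)\<close>.
\<close>

unbundle no vec_syntax
unbundle fps_syntax

section \<open>Hooks and bead sets\<close>

text \<open>Everything is done at a finite cut-off, parts below \<open>t * M\<close>, where the sum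
  over sets of parts factors exactly; the limit is then taken coefficientwise in each factor. A run
  has weight \<open>x ^ 2\<close> because the bead set is antisymmetric about 0, so a hook has a
  mirror image under \<open>a \<mapsto> t - a\<close>. At the start of a one-sided word the mirror
  image is either the same hook or would need 0 as a bead, hence the single \<open>x\<close>. This
  boundary weight is the obstacle: it destroys the geometric weights for which the domino sum has a
  closed form. Correcting it costs a second domino sum, with \<open>z * q\<close> in place of
  \<open>z\<close>. A contiguous relation between two series with equal denominators eliminates that
  second sum, but only after multiplication by \<open>1 + x\<close>, one factor of
  \<open>a = (1 - x) * (1 + x)\<close>. This is the origin of \<open>1 / (1 + x)\<close> in
  \<open>D_star\<close>. The square roots in \<open>H_star\<close> come from the class of
  \<open>t / 2\<close>: there the series are the even-indexed part of an Euler expansion with base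
  \<open>- (q ^ t)\<close>, whose argument must have square \<open>a\<close>, up to a power of
  \<open>q\<close>.\<close>

lemma downward_closed_eq_lessThan:
  fixes A :: "nat set"
  assumes "finite A" "\<And>i i'. i \<in> A \<Longrightarrow> i' \<le> i \<Longrightarrow> i' \<in> A"
  shows "A = {..<card A}"
proof (cases "A = {}")
  case False
  then have "Max A \<in> A"
    using assms(1) by simp
  then have "A = {..Max A}"
    using Max_ge[OF assms(1)] assms(2)[OF \<open>Max A \<in> A\<close>] by blast
  then show ?thesis
    by (metis card_lessThan lessThan_Suc_atMost)
qed auto

section \<open>Young diagrams through row and column lengths\<close>

definition row_len :: "nat list \<Rightarrow> nat \<Rightarrow> nat" where
  "row_len mu i = (if i < length mu then mu ! i else 0)"

definition col_len :: "nat list \<Rightarrow> nat \<Rightarrow> nat" where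
  "col_len mu j = card {i. j < row_len mu i}"

lemma young_iff_row: "(i, j) \<in> young mu \<longleftrightarrow> j < row_len mu i"
  by (auto simp: young_def row_len_def)

lemma row_antimono: "is_partition mu \<Longrightarrow> i \<le> i' \<Longrightarrow> row_len mu i' \<le> row_len mu i"
  by (cases "i = i'") (auto simp: is_partition_def row_len_def sorted_wrt_iff_nth_less)

lemma less_row_iff_less_col:
  assumes "is_partition mu"
  shows "j < row_len mu i \<longleftrightarrow> i < col_len mu j"
proof -
  have "{i. j < row_len mu i} = {..<card {i. j < row_len mu i}}"
  proof (rule downward_closed_eq_lessThan)
    show "finite {i. j < row_len mu i}"
      by (rule finite_subset[of _ "{..<length mu}"]) (auto simp: row_len_def split: if_splits)
  next
    fix i i' assume "i \<in> {i. j < row_len mu i}" "i' \<le> i"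
    then show "i' \<in> {i. j < row_len mu i}"
      using row_antimono[OF assms, of i' i] by simp
  qed
  then show ?thesis
    unfolding col_len_def by blast
qed

lemma col_antimono: "is_partition mu \<Longrightarrow> j \<le> j' \<Longrightarrow> col_len mu j' \<le> col_len mu j"
  by (meson less_row_iff_less_col linorder_not_le order.strict_trans1 order.irrefl)

lemma length_eq_card_young:
  assumes "is_partition mu"
  shows "length mu = card {i. (i, 0) \<in> young mu}"
proof -
  have "{i. (i, 0) \<in> young mu} = {..<length mu}"
    using assms by (auto simp: young_def is_partition_def)
  then show ?thesis by simp
qed

lemma young_inject:
  assumes "is_partition mu" "is_partition nu" "young mu = young nu"
  shows "mu = nu"
proof (rule nth_equalityI)
  show len: "length mu = length nu"
    using assms length_eq_card_young by metis
  fix i assume "i < length mu"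
  then have "{j. (i, j) \<in> young mu} = {..<mu ! i}" "{j. (i, j) \<in> young nu} = {..<nu ! i}"
    using len by (auto simp: young_def)
  then show "mu ! i = nu ! i"
    using assms(3) by simp
qed

lemma ex_partition_young:
  assumes "finite D" and down: "\<And>i j i' j'. (i, j) \<in> D \<Longrightarrow> i' \<le> i \<Longrightarrow> j' \<le> j \<Longrightarrow> (i', j') \<in> D"
  shows "\<exists>mu. is_partition mu \<and> young mu = D"
proof -
  have fin: "finite {j. (i, j) \<in> D}" for i
    using finite_subset[OF _ finite_imageI[OF assms(1), of snd], of "{j. (i, j) \<in> D}"] by force
  have fin0: "finite {i. (i, 0) \<in> D}"
    using finite_subset[OF _ finite_imageI[OF assms(1), of fst], of "{i. (i, 0) \<in> D}"] by force
  define r where "r i = card {j. (i, j) \<in> D}" for i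
  define l where "l = card {i. (i, 0) \<in> D}"
  have r: "(i, j) \<in> D \<longleftrightarrow> j < r i" for i j
  proof -
    have "{j. (i, j) \<in> D} = {..<r i}"
      unfolding r_def by (rule downward_closed_eq_lessThan[OF fin]) (auto intro: down)
    then show ?thesis by blast
  qed
  have l: "(i, 0) \<in> D \<longleftrightarrow> i < l" for i
  proof -
    have "{i. (i, 0) \<in> D} = {..<l}"
      unfolding l_def by (rule downward_closed_eq_lessThan[OF fin0]) (auto intro: down)
    then show ?thesis by blast
  qed
  have anti: "r i' \<le> r i" if "i \<le> i'" for i i'
    using down[of i' _ i] r that by (meson linorder_not_le order.refl)
  have "is_partition (map r [0..<l])"
    using l r by (auto simp: is_partition_def sorted_wrt_iff_nth_less intro: anti)
  moreover have "young (map r [0..<l]) = D"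
  proof -
    have "(i, j) \<in> young (map r [0..<l]) \<longleftrightarrow> (i, j) \<in> D" for i j
      using r l down[of i j i 0] by (auto simp: young_def)
    then show ?thesis by auto
  qed
  ultimately show ?thesis by blast
qed

text \<open>The boundary of the diagram read as a two-sided word: beads are the vertical steps, gaps
  the horizontal ones. Rows past the last have length 0, so every natural number indexes a bead, and
  the final \<open>- 1\<close> gives the empty partition exactly the negative integers as
  beads.\<close>

definition beads :: "nat list \<Rightarrow> nat \<Rightarrow> int" where
  "beads mu i = int (row_len mu i) - int i - 1"

definition gaps :: "nat list \<Rightarrow> nat \<Rightarrow> int" where
  "gaps mu j = int j - int (col_len mu j)"

lemma gaps_less_beads_iff:
  assumes "is_partition mu"
  shows "gaps mu j < beads mu i \<longleftrightarrow> j < row_len mu i"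
  using less_row_iff_less_col[OF assms, of j i] by (auto simp: gaps_def beads_def)

lemma gaps_neq_beads: "is_partition mu \<Longrightarrow> gaps mu j \<noteq> beads mu i"
  using less_row_iff_less_col[of mu j i] by (cases "j < row_len mu i") (auto simp: gaps_def beads_def)

lemma inj_beads: "is_partition mu \<Longrightarrow> inj (beads mu)"
proof (rule linorder_injI)
  fix i i' :: nat
  assume "is_partition mu" "i < i'"
  then show "beads mu i \<noteq> beads mu i'"
    using row_antimono[of mu i i'] by (simp add: beads_def)
qed

lemma inj_gaps: "is_partition mu \<Longrightarrow> inj (gaps mu)"
proof (rule linorder_injI)
  fix j j' :: nat
  assume "is_partition mu" "j < j'"
  then show "gaps mu j \<noteq> gaps mu j'"
    using col_antimono[of mu j j'] by (simp add: gaps_def)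
qed

lemma not_beads_iff_gaps:
  assumes "is_partition mu"
  shows "a \<notin> range (beads mu) \<longleftrightarrow> a \<in> range (gaps mu)"
proof
  assume "a \<in> range (gaps mu)"
  then show "a \<notin> range (beads mu)"
    using gaps_neq_beads[OF assms] by (metis imageE)
next
  assume a: "a \<notin> range (beads mu)"
  define i where "i = (LEAST i. beads mu i \<le> a)"
  have "beads mu (length mu + nat \<bar>a\<bar>) \<le> a"
    by (simp add: beads_def row_len_def)
  then have "beads mu i \<le> a"
    unfolding i_def by (rule LeastI)
  moreover have "beads mu i \<noteq> a"
    using a by blast
  ultimately have i: "int (row_len mu i) \<le> a + int i"
    by (simp add: beads_def)
  \<comment> \<open>The column whose gap would be \<open>a\<close> if it had exactly
    \<open>i\<close> boxes; the minimality of \<open>i\<close> shows that it has.\<close>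
  define j where "j = nat (a + int i)"
  have j: "int j = a + int i"
    using i by (simp add: j_def)
  have "i' < col_len mu j \<longleftrightarrow> i' < i" for i'
  proof
    assume "i' < col_len mu j"
    then have "j < row_len mu i'" by (simp add: less_row_iff_less_col[OF assms])
    with i j show "i' < i"
      using row_antimono[OF assms, of i i'] by (cases "i \<le> i'") auto
  next
    assume "i' < i"
    then have "\<not> beads mu (i - 1) \<le> a" "i' \<le> i - 1"
      using not_less_Least[of "i - 1" "\<lambda>i. beads mu i \<le> a"] by (auto simp flip: i_def)
    then have "a + int i < int (row_len mu (i - 1))"
      using \<open>i' < i\<close> by (simp add: beads_def)
    then show "i' < col_len mu j"
      using j row_antimono[OF assms \<open>i' \<le> i - 1\<close>] by (simp flip: less_row_iff_less_col[OF assms])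
  qed
  then have "col_len mu j = i"
    by (meson linorder_neqE_nat order.irrefl)
  then have "gaps mu j = a"
    using j by (simp add: gaps_def)
  then show "a \<in> range (gaps mu)" by blast
qed

text \<open>Arm plus leg plus 1 rearranges into a bead minus a gap. Hence a \<open>t\<close>-hook is
  a bead \<open>a\<close> for which \<open>a - t\<close> is a gap.\<close>

lemma card_hook:
  assumes "is_partition mu" "j < row_len mu i"
  shows "int (card (hook mu (i, j))) = beads mu i - gaps mu j"
proof -
  have ij: "i < col_len mu j"
    using assms by (simp add: less_row_iff_less_col)
  have "hook mu (i, j) = Pair i ` {j..<row_len mu i} \<union> (\<lambda>i'. (i', j)) ` {Suc i..<col_len mu j}"
    using assms(2) unfolding hook_def young_iff_row
    by (auto simp: less_row_iff_less_col[OF assms(1)] image_iff Suc_le_eq)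
  also have "card \<dots> = (row_len mu i - j) + (col_len mu j - Suc i)"
    by (subst card_Un_disjoint) (auto simp: card_image inj_on_def)
  finally show ?thesis
    using assms(2) ij by (simp add: beads_def gaps_def)
qed

lemma num_hooks_eq_card_beads:
  assumes mu: "is_partition mu" and "t > 0"
  shows "num_hooks t mu = card {a \<in> range (beads mu). a - int t \<notin> range (beads mu)}"
proof -
  have "bij_betw (\<lambda>(i, j). beads mu i) {b \<in> young mu. card (hook mu b) = t}
          {a \<in> range (beads mu). a - int t \<notin> range (beads mu)}"
  proof (rule bij_betwI')
    fix b b' assume b: "b \<in> {b \<in> young mu. card (hook mu b) = t}"
      and b': "b' \<in> {b \<in> young mu. card (hook mu b) = t}"
    obtain i j i' j' where ij: "b = (i, j)" "b' = (i', j')" by fastforce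
    have "gaps mu j = beads mu i - int t" "gaps mu j' = beads mu i' - int t"
      using b b' card_hook[OF mu, of j i] card_hook[OF mu, of j' i'] by (auto simp: ij young_iff_row)
    then show "((case b of (i, j) \<Rightarrow> beads mu i) = (case b' of (i, j) \<Rightarrow> beads mu i)) = (b = b')"
      using injD[OF inj_beads[OF mu], of i i'] injD[OF inj_gaps[OF mu], of j j'] by (auto simp: ij)
  next
    fix b assume b: "b \<in> {b \<in> young mu. card (hook mu b) = t}"
    obtain i j where ij: "b = (i, j)" by fastforce
    have "gaps mu j = beads mu i - int t"
      using b card_hook[OF mu, of j i] by (auto simp: ij young_iff_row)
    then have "beads mu i - int t \<in> range (gaps mu)" by (metis rangeI)
    then show "(case b of (i, j) \<Rightarrow> beads mu i) \<in>
        {a \<in> range (beads mu). a - int t \<notin> range (beads mu)}"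
      by (simp add: ij not_beads_iff_gaps[OF mu])
  next
    fix a assume "a \<in> {a \<in> range (beads mu). a - int t \<notin> range (beads mu)}"
    then obtain i j where a: "a = beads mu i" "a - int t = gaps mu j"
      using not_beads_iff_gaps[OF mu, of "a - int t"] by auto
    \<comment> \<open>A gap below a bead always marks a box of the diagram; \<open>t > 0\<close>
      puts the gap \<open>a - t\<close> below the bead \<open>a\<close>.\<close>
    then have j: "j < row_len mu i"
      using gaps_less_beads_iff[OF mu, of j i] \<open>t > 0\<close> by auto
    then have "card (hook mu (i, j)) = t"
      using card_hook[OF mu j] a by simp
    with a j show "\<exists>b\<in>{b \<in> young mu. card (hook mu b) = t}. a = (case b of (i, j) \<Rightarrow> beads mu i)"
      by (intro bexI[of _ "(i, j)"]) (auto simp: young_iff_row)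
  qed
  then show ?thesis
    unfolding num_hooks_def by (rule bij_betw_same_card)
qed

text \<open>For \<open>a \<noteq> 0\<close> exactly one of \<open>a\<close> and \<open>- a\<close>
  is a member, while 0 never is. This exceptional point is why the class of 0 needs its own
  treatment.\<close>

definition maya :: "nat set \<Rightarrow> int set" where
  "maya S = {a. (a > 0 \<and> nat a \<in> S) \<or> (a < 0 \<and> nat (- a) \<notin> S)}"

text \<open>Distinct parts drop by at least 1 at each step, which compensates the shift of the rows.
  This makes both halves of the doubled diagram fit together into a Young diagram.\<close>

lemma strict_partition_nth_mono:
  assumes "is_strict_partition la" "i \<le> i'" "i' < length la"
  shows "la ! i' + i' \<le> la ! i + i"
  using assms(2,3)
proof (induction i' rule: dec_induct)
  case (step n)
  have "la ! Suc n < la ! n"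
    using assms(1) step by (auto simp: is_strict_partition_def sorted_wrt_iff_nth_less)
  with step show ?case by simp
qed auto

lemma strict_partition_nth_pos: "is_strict_partition la \<Longrightarrow> i < length la \<Longrightarrow> 0 < la ! i"
  by (auto simp: is_strict_partition_def)

lemma doubled_diagram_iff:
  "(i, j) \<in> shifted_diagram la \<union> added_boxes la \<longleftrightarrow>
     (if i < j then i < length la \<and> j \<le> la ! i + i else j < length la \<and> i < la ! j + j)"
  by (auto simp: shifted_diagram_def added_boxes_def)

text \<open>With \<open>l = length la\<close>, the first \<open>l\<close> rows and columns have
  lengths \<open>la ! i + i + 1\<close> and \<open>la ! j + j\<close>, hence beads
  \<open>la ! i\<close> and gaps \<open>- (la ! j)\<close>. The square of side \<open>l\<close>
  absorbs the rest: later rows have at most \<open>l\<close> boxes and so negative beads, later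
  columns have nonnegative gaps. Thus the positive beads and the negative gaps are known, and
  complementation gives the negative beads.\<close>

lemma beads_doubled:
  assumes la: "is_strict_partition la" and d: "is_doubled la mu"
  shows "range (beads mu) = maya (set la)"
proof -
  have mu: "is_partition mu" and y: "young mu = shifted_diagram la \<union> added_boxes la"
    using d by (auto simp: is_doubled_def)
  have row_iff: "j < row_len mu i \<longleftrightarrow>
      (if i < j then i < length la \<and> j \<le> la ! i + i else j < length la \<and> i < la ! j + j)" for i j
    unfolding young_iff_row[symmetric] y by (rule doubled_diagram_iff)
  note mono = strict_partition_nth_mono[OF la] and pos = strict_partition_nth_pos[OF la]
  have eq_iff: "m = n" if "\<And>k. k < m \<longleftrightarrow> k < n" for m n :: nat
    using that by (meson linorder_neqE_nat order.irrefl)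
  have row: "row_len mu i = la ! i + Suc i" if "i < length la" for i
  proof (rule eq_iff)
    show "j < row_len mu i \<longleftrightarrow> j < la ! i + Suc i" for j
      unfolding row_iff using that mono[of j i] pos[OF that] by auto
  qed
  have col: "col_len mu j = la ! j + j" if "j < length la" for j
  proof (rule eq_iff)
    show "i < col_len mu j \<longleftrightarrow> i < la ! j + j" for i
      unfolding less_row_iff_less_col[OF mu, symmetric] row_iff
      using that mono[of i j] pos[OF that] by auto
  qed
  have beads1: "beads mu i = int (la ! i)" if "i < length la" for i
    using row[OF that] by (simp add: beads_def)
  have gaps1: "gaps mu j = - int (la ! j)" if "j < length la" for j
    using col[OF that] by (simp add: gaps_def)
  have beads2: "beads mu i < 0" if "\<not> i < length la" for i
  proof -
    have "\<not> length la < row_len mu i"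
      using that by (simp add: row_iff)
    with that show ?thesis by (simp add: beads_def)
  qed
  have gaps2: "gaps mu j \<ge> 0" if "\<not> j < length la" for j
  proof -
    have "\<not> length la < col_len mu j"
      unfolding less_row_iff_less_col[OF mu, symmetric] using that by (simp add: row_iff)
    with that show ?thesis by (simp add: gaps_def)
  qed
  have "a \<in> range (beads mu) \<longleftrightarrow> a \<in> maya (set la)" for a
  proof (cases "a < 0")
    case True
    have "a \<in> range (gaps mu) \<longleftrightarrow> nat (- a) \<in> set la"
    proof
      assume "a \<in> range (gaps mu)"
      then obtain j where "a = gaps mu j" by auto
      with True show "nat (- a) \<in> set la"
        using gaps1[of j] gaps2[of j] by (cases "j < length la") auto
    next
      assume "nat (- a) \<in> set la"
      then obtain j where "j < length la" "la ! j = nat (- a)" by (auto simp: in_set_conv_nth)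
      with True have "gaps mu j = a" by (simp add: gaps1)
      then show "a \<in> range (gaps mu)" by blast
    qed
    with True show ?thesis
      using not_beads_iff_gaps[OF mu, of a] by (auto simp: maya_def)
  next
    case False
    have "a \<in> range (beads mu) \<longleftrightarrow> a > 0 \<and> nat a \<in> set la"
    proof
      assume "a \<in> range (beads mu)"
      then obtain i where "a = beads mu i" by auto
      with False show "a > 0 \<and> nat a \<in> set la"
        using beads1[of i] beads2[of i] pos[of i] by (cases "i < length la") auto
    next
      assume "a > 0 \<and> nat a \<in> set la"
      then obtain i where "i < length la" "la ! i = nat a" by (auto simp: in_set_conv_nth)
      with False have "beads mu i = a" by (simp add: beads1)
      then show "a \<in> range (beads mu)" by blast
    qed
    with False show ?thesis by (auto simp: maya_def)
  qed
  then show ?thesis by auto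
qed

lemma strict_partition_distinct: "is_strict_partition la \<Longrightarrow> distinct la"
  unfolding is_strict_partition_def
  by (metis distinct_rev sorted_wrt_rev strict_sorted_iff)

lemma finite_doubled_diagram: "finite (shifted_diagram la \<union> added_boxes la)"
proof (rule finite_subset)
  let ?N = "length la + Max (insert 0 (set la))"
  have bound: "k + la ! k \<le> ?N" if "k < length la" for k
  proof -
    have "la ! k \<le> Max (insert 0 (set la))"
      using that by (intro Max_ge) auto
    with that show ?thesis by linarith
  qed
  show "shifted_diagram la \<union> added_boxes la \<subseteq> {..?N} \<times> {..?N}"
  proof (rule subrelI)
    fix i j assume "(i, j) \<in> shifted_diagram la \<union> added_boxes la"
    then show "(i, j) \<in> {..?N} \<times> {..?N}"
      using bound[of i] bound[of j] unfolding doubled_diagram_iff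
      by (auto split: if_splits)
  qed
qed simp

lemma size_doubled:
  assumes la: "is_strict_partition la" and d: "is_doubled la mu"
  shows "sum_list mu = 2 * \<Sum>(set la)"
proof -
  have "young mu = Sigma {..<length mu} (\<lambda>i. {..<mu ! i})"
    by (auto simp: young_def)
  then have "sum_list mu = card (young mu)"
    by (simp add: sum_list_sum_nth atLeast0LessThan)
  also have "\<dots> = card (shifted_diagram la) + card (added_boxes la)"
  proof -
    have "shifted_diagram la \<inter> added_boxes la = {}"
      by (auto simp: shifted_diagram_def added_boxes_def)
    then show ?thesis
      using d finite_doubled_diagram[of la] by (simp add: is_doubled_def card_Un_disjoint)
  qed
  also have "card (shifted_diagram la) = sum_list la"
  proof -
    have "shifted_diagram la = Sigma {..<length la} (\<lambda>i. {i<..i + la ! i})"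
      by (auto simp: shifted_diagram_def)
    then show ?thesis by (simp add: sum_list_sum_nth atLeast0LessThan)
  qed
  also have "card (added_boxes la) = sum_list la"
  proof -
    have "added_boxes la = prod.swap ` Sigma {..<length la} (\<lambda>j. {j..<j + la ! j})"
      by (auto simp: added_boxes_def image_iff)
    then have "card (added_boxes la) = card (Sigma {..<length la} (\<lambda>j. {j..<j + la ! j}))"
      by (simp add: card_image)
    then show ?thesis by (simp add: sum_list_sum_nth atLeast0LessThan)
  qed
  also have "sum_list la = \<Sum>(set la)"
    using sum.distinct_set_conv_list[OF strict_partition_distinct[OF la], of "\<lambda>x. x"] by simp
  finally show ?thesis by simp
qed

lemma ex_doubled:
  assumes la: "is_strict_partition la"
  shows "\<exists>mu. is_doubled la mu"
proof -
  let ?D = "shifted_diagram la \<union> added_boxes la"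
  have "\<exists>mu. is_partition mu \<and> young mu = ?D"
  proof (rule ex_partition_young)
    show "finite ?D" by (rule finite_doubled_diagram)
  next
    fix i j i' j' assume "(i, j) \<in> ?D" "i' \<le> i" "j' \<le> j"
    then show "(i', j') \<in> ?D"
      unfolding doubled_diagram_iff
      using strict_partition_nth_mono[OF la, of i' i] strict_partition_nth_mono[OF la, of i' j]
        strict_partition_nth_mono[OF la, of j' i] strict_partition_nth_mono[OF la, of j' j]
      by (auto split: if_splits)
  qed
  then show ?thesis by (simp add: is_doubled_def)
qed

section \<open>Finite sets of parts in place of doubled distinct partitions\<close>

lemma strict_partition_unique:
  assumes "is_strict_partition la"
  shows "la = rev (sorted_list_of_set (set la))"
proof -
  have "sorted_wrt (<) (rev la)"
    using assms by (simp add: is_strict_partition_def sorted_wrt_rev)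
  then have "sorted_list_of_set (set (rev la)) = rev la"
    by (intro sorted_list_of_set.idem_if_sorted_distinct) (auto simp: strict_sorted_iff)
  then show ?thesis by simp
qed

lemma strict_partition_of_set:
  assumes "finite S" "0 \<notin> S"
  shows "is_strict_partition (rev (sorted_list_of_set S))"
  using assms
  by (auto simp: is_strict_partition_def sorted_wrt_rev intro: gr0I
      simp flip: strict_sorted_iff)

definition hook_count :: "nat \<Rightarrow> nat set \<Rightarrow> nat" where
  "hook_count t S = card {a \<in> maya S. a - int t \<notin> maya S}"

lemma F_series_nth:
  assumes "t > 0"
  shows "fps_nth (F_series t x) n =
    (\<Sum>S | finite S \<and> 0 \<notin> S \<and> 2 * \<Sum>S = n. x ^ hook_count t S)"
proof -
  define f where "f S = (SOME mu. is_doubled (rev (sorted_list_of_set S)) mu)" for S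
  have f: "is_doubled (rev (sorted_list_of_set S)) (f S)" if "finite S" "0 \<notin> S" for S
    unfolding f_def using ex_doubled[OF strict_partition_of_set[OF that]] by (rule someI_ex)
  \<comment> \<open>The positive beads of a doubled distinct partition are the parts of its strict
    partition, so \<open>g\<close> inverts \<open>f\<close>.\<close>
  define g where "g mu = {n. 0 < n \<and> int n \<in> range (beads mu)}" for mu
  have g: "g mu = set la" if "is_strict_partition la" "is_doubled la mu" for la mu
    using that(1) unfolding g_def beads_doubled[OF that] by (auto simp: maya_def is_strict_partition_def)
  show ?thesis
    unfolding F_series_def fps_nth_Abs_fps
  proof (rule sum.reindex_bij_witness[where i = f and j = g])
    fix mu assume "mu \<in> {mu \<in> DD. sum_list mu = n}"
    then obtain la where la: "is_strict_partition la" "is_doubled la mu" "sum_list mu = n"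
      by (auto simp: DD_def)
    have "f (set la) = mu"
    proof -
      have "is_doubled la (f (set la))"
        using f[of "set la"] la(1) strict_partition_unique[OF la(1)]
        by (auto simp: is_strict_partition_def)
      with la(2) show ?thesis
        by (auto simp: is_doubled_def intro: young_inject)
    qed
    then show "f (g mu) = mu" using g[OF la(1,2)] by simp
    show "g mu \<in> {S. finite S \<and> 0 \<notin> S \<and> 2 * \<Sum>S = n}"
      using g[OF la(1,2)] size_doubled[OF la(1,2)] la by (auto simp: is_strict_partition_def)
    have "is_partition mu" using la(2) by (simp add: is_doubled_def)
    then show "x ^ hook_count t (g mu) = x ^ num_hooks t mu"
      using num_hooks_eq_card_beads[OF _ assms, of mu] beads_doubled[OF la(1,2)]
      by (simp add: hook_count_def g[OF la(1,2)])
  next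
    fix S assume "S \<in> {S. finite S \<and> 0 \<notin> S \<and> 2 * \<Sum>S = n}"
    then have S: "finite S" "0 \<notin> S" "2 * \<Sum>S = n" by auto
    note la = strict_partition_of_set[OF S(1,2)] f[OF S(1,2)]
    show "g (f S) = S" using g[OF la] S by simp
    show "f S \<in> {mu \<in> DD. sum_list mu = n}"
      using size_doubled[OF la] la S by (auto simp: DD_def)
  qed
qed

section \<open>Infinite products of formal power series\<close>

lemma tendsto_mult_fps:
  fixes f g :: "'b \<Rightarrow> 'a::comm_ring_1 fps"
  assumes "(f \<longlongrightarrow> a) F" "(g \<longlongrightarrow> b) F"
  shows "((\<lambda>x. f x * g x) \<longlongrightarrow> a * b) F"
proof (rule tendsto_fpsI)
  fix n
  have "eventually (\<lambda>x. \<forall>i\<in>{..n}. f x $ i = a $ i) F"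
    using assms(1) by (intro eventually_ball_finite) (auto simp: tendsto_fps_iff)
  moreover have "eventually (\<lambda>x. \<forall>i\<in>{..n}. g x $ i = b $ i) F"
    using assms(2) by (intro eventually_ball_finite) (auto simp: tendsto_fps_iff)
  ultimately show "eventually (\<lambda>x. (f x * g x) $ n = (a * b) $ n) F"
    by eventually_elim (auto simp: fps_mult_nth intro!: sum.cong)
qed

lemma tendsto_add_fps:
  fixes f g :: "'b \<Rightarrow> 'a::comm_ring_1 fps"
  assumes "(f \<longlongrightarrow> a) F" "(g \<longlongrightarrow> b) F"
  shows "((\<lambda>x. f x + g x) \<longlongrightarrow> a + b) F"
proof (rule tendsto_fpsI)
  fix n
  have "eventually (\<lambda>x. f x $ n = a $ n) F" "eventually (\<lambda>x. g x $ n = b $ n) F"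
    using assms by (auto simp: tendsto_fps_iff)
  then show "eventually (\<lambda>x. (f x + g x) $ n = (a + b) $ n) F"
    by eventually_elim auto
qed

lemma tendsto_diff_fps:
  fixes f g :: "'b \<Rightarrow> 'a::comm_ring_1 fps"
  assumes "(f \<longlongrightarrow> a) F" "(g \<longlongrightarrow> b) F"
  shows "((\<lambda>x. f x - g x) \<longlongrightarrow> a - b) F"
proof (rule tendsto_fpsI)
  fix n
  have "eventually (\<lambda>x. f x $ n = a $ n) F" "eventually (\<lambda>x. g x $ n = b $ n) F"
    using assms by (auto simp: tendsto_fps_iff)
  then show "eventually (\<lambda>x. (f x - g x) $ n = (a - b) $ n) F"
    by eventually_elim auto
qed

lemma tendsto_prod_finite_fps:
  fixes f :: "'c \<Rightarrow> 'b \<Rightarrow> 'a::comm_ring_1 fps"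
  assumes "\<And>i. i \<in> I \<Longrightarrow> (f i \<longlongrightarrow> l i) F"
  shows "((\<lambda>x. \<Prod>i\<in>I. f i x) \<longlongrightarrow> (\<Prod>i\<in>I. l i)) F"
  using assms by (induction I rule: infinite_finite_induct) (auto intro: tendsto_mult_fps)

lemma fps_nth_mult_power_eq_0:
  fixes q f :: "'a::comm_ring_1 fps"
  assumes "q $ 0 = 0" "d < k"
  shows "(q ^ k * f) $ d = 0"
  using startsby_zero_power_prefix[of q k] assms by (auto simp: fps_mult_nth intro!: sum.neutral)

text \<open>A discrete form of Tannery's theorem: coefficient \<open>d\<close> sees only the indices
  \<open>m \<le> g d\<close>, uniformly in \<open>n\<close>, so termwise limits pass through sums of
  growing length.\<close>

lemma tendsto_sum_fps_dominated:
  fixes T :: "nat \<Rightarrow> nat \<Rightarrow> 'a::comm_ring_1 fps"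
  assumes lim: "\<And>m. (\<lambda>n. T n m) \<longlonglongrightarrow> T' m"
    and ord: "\<And>n m d. g d < m \<Longrightarrow> T n m $ d = 0"
    and N: "filterlim N at_top sequentially"
    and S: "T' sums S"
  shows "(\<lambda>n. \<Sum>m<N n. T n m) \<longlonglongrightarrow> S"
proof (rule tendsto_fpsI)
  fix d
  have ord': "T' m $ d = 0" if "g d < m" for m
  proof -
    have "eventually (\<lambda>n. T n m $ d = T' m $ d) sequentially"
      using lim by (auto simp: tendsto_fps_iff)
    then obtain n where "T n m $ d = T' m $ d"
      by (auto simp: eventually_sequentially)
    with ord[OF that] show ?thesis by simp
  qed
  have cut: "(\<Sum>m<k. f m $ d) = (\<Sum>m\<le>g d. f m $ d)"
    if "g d < k" "\<And>m. g d < m \<Longrightarrow> f m $ d = 0" for k and f :: "nat \<Rightarrow> 'a fps"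
    using that by (intro sum.mono_neutral_right) auto
  have "eventually (\<lambda>n. (\<Sum>m<n. T' m) $ d = S $ d) sequentially"
    using S by (auto simp: sums_def tendsto_fps_iff)
  with eventually_gt_at_top[of "g d"]
  have "eventually (\<lambda>n::nat. S $ d = (\<Sum>m\<le>g d. T' m $ d)) sequentially"
    by eventually_elim (use ord' in \<open>auto simp: fps_sum_nth cut\<close>)
  then have Sd: "S $ d = (\<Sum>m\<le>g d. T' m $ d)"
    by simp
  have "eventually (\<lambda>n. \<forall>m\<in>{..g d}. T n m $ d = T' m $ d) sequentially"
    using lim by (intro eventually_ball_finite) (auto simp: tendsto_fps_iff)
  moreover have "eventually (\<lambda>n. g d < N n) sequentially"
    using N[unfolded filterlim_at_top, THEN spec, of "Suc (g d)"] by (simp add: Suc_le_eq)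
  ultimately show "eventually (\<lambda>n. (\<Sum>m<N n. T n m) $ d = S $ d) sequentially"
    by eventually_elim (auto simp: fps_sum_nth cut ord Sd)
qed

lemma summable_fps:
  fixes f :: "nat \<Rightarrow> 'a::comm_ring_1 fps"
  assumes "\<And>m d. g d < m \<Longrightarrow> f m $ d = 0"
  shows "summable f"
proof -
  have "f sums Abs_fps (\<lambda>d. \<Sum>m\<le>g d. f m $ d)"
    unfolding sums_def
  proof (rule tendsto_fpsI)
    fix d
    show "eventually (\<lambda>n. (\<Sum>m<n. f m) $ d = Abs_fps (\<lambda>d. \<Sum>m\<le>g d. f m $ d) $ d) sequentially"
      using eventually_gt_at_top[of "g d"]
    proof eventually_elim
      case (elim n)
      then have "(\<Sum>m<n. f m $ d) = (\<Sum>m\<le>g d. f m $ d)"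
        using assms by (intro sum.mono_neutral_right) auto
      then show ?case by (simp add: fps_sum_nth)
    qed
  qed
  then show ?thesis by (rule sums_summable)
qed

lemma sums_mult_fps:
  fixes f :: "nat \<Rightarrow> 'a::comm_ring_1 fps"
  assumes "f sums S"
  shows "(\<lambda>m. c * f m) sums (c * S)"
  using tendsto_mult_fps[OF tendsto_const assms[unfolded sums_def], of c]
  by (simp add: sums_def sum_distrib_left)

section \<open>Finite and infinite q-Pochhammer products\<close>

definition qpoch :: "'a::comm_ring_1 \<Rightarrow> 'a \<Rightarrow> nat \<Rightarrow> 'a" where
  "qpoch a q n = (\<Prod>k<n. 1 - a * q ^ k)"

lemma qpoch_0 [simp]: "qpoch a q 0 = 1"
  and qpoch_Suc: "qpoch a q (Suc n) = qpoch a q n * (1 - a * q ^ n)"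
  by (simp_all add: qpoch_def)

lemma qpoch_Suc': "qpoch a q (Suc n) = (1 - a) * qpoch (a * q) q n"
  unfolding qpoch_def prod.lessThan_Suc_shift by (simp add: mult_ac)

lemma qpoch_add: "qpoch a q (m + n) = qpoch a q m * qpoch (a * q ^ m) q n"
  by (induction n) (simp_all add: qpoch_Suc power_add mult_ac)

lemma qpoch_nth_0: "q $ 0 = 0 \<Longrightarrow> a $ 0 = 0 \<Longrightarrow> qpoch a q n $ 0 = 1"
  for a q :: "'a::comm_ring_1 fps"
  by (induction n) (auto simp: qpoch_Suc)

lemma convergent_qpoch:
  fixes a q :: "'a::field_char_0 fps"
  assumes "q $ 0 = 0"
  shows "convergent (qpoch a q)"
proof -
  define L where "L = Abs_fps (\<lambda>d. qpoch a q (Suc d) $ d)"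
  have eq: "qpoch a q n $ d = qpoch a q (Suc d) $ d" if "n \<ge> Suc d" for n d
    using that
  proof (induction n rule: dec_induct)
    case (step n)
    have "(q ^ n * (qpoch a q n * a)) $ d = 0"
      by (rule fps_nth_mult_power_eq_0) (use assms step in auto)
    with step.IH show ?case
      by (simp add: qpoch_Suc algebra_simps)
  qed auto
  have "qpoch a q \<longlonglongrightarrow> L"
  proof (rule tendsto_fpsI)
    fix d
    show "eventually (\<lambda>n. qpoch a q n $ d = L $ d) sequentially"
      using eventually_ge_at_top[of "Suc d"]
      by eventually_elim (unfold L_def fps_nth_Abs_fps, rule eq)
  qed
  then show ?thesis by (rule convergentI)
qed

text \<open>The value of an infinite product is tied to the partial products through a nonzero limit
  after the last zero factor. Only the factor \<open>1 - a\<close> can vanish, because all later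
  ones have constant term 1; it is split off, and \<open>a = 1\<close> is treated apart.\<close>

lemma qpoch_LIMSEQ:
  fixes a q :: "'a::field_char_0 fps"
  assumes "q $ 0 = 0"
  shows "qpoch a q \<longlonglongrightarrow> qpoch_inf a q"
proof -
  let ?f = "\<lambda>k. 1 - a * q ^ k"
  obtain L where L: "qpoch (a * q) q \<longlonglongrightarrow> L"
    using convergent_qpoch[OF assms] unfolding convergent_def by blast
  have "eventually (\<lambda>n. qpoch (a * q) q n $ 0 = L $ 0) sequentially"
    using L by (simp add: tendsto_fps_iff)
  then have "L $ 0 = 1"
    using assms by (simp add: qpoch_nth_0)
  then have "L \<noteq> 0" by auto
  have lim: "qpoch a q \<longlonglongrightarrow> (1 - a) * L"
    by (rule filterlim_sequentially_Suc[THEN iffD1])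
       (simp add: qpoch_Suc' tendsto_mult_fps[OF tendsto_const L])
  have "?f has_prod ((1 - a) * L)"
  proof (cases "a = 1")
    case True
    have "raw_has_prod ?f (Suc 0) L"
      using filterlim_sequentially_Suc[THEN iffD2, OF L] \<open>L \<noteq> 0\<close>
      by (auto simp: raw_has_prod_def qpoch_def mult_ac lessThan_Suc_atMost)
    then show ?thesis
      using True unfolding has_prod_def by (intro disjI2 exI[of _ 0] exI[of _ L]) auto
  next
    case False
    have "raw_has_prod ?f 0 ((1 - a) * L)"
      using filterlim_sequentially_Suc[THEN iffD2, OF lim] \<open>L \<noteq> 0\<close> False
      by (auto simp: raw_has_prod_def qpoch_def mult_ac lessThan_Suc_atMost)
    then show ?thesis by (simp add: has_prod_def)
  qed
  then have "qpoch_inf a q = (1 - a) * L"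
    unfolding qpoch_inf_def using has_prod_unique by metis
  with lim show ?thesis by simp
qed

lemma qpoch_inf_split:
  fixes a q :: "'a::field_char_0 fps"
  assumes "q $ 0 = 0"
  shows "qpoch_inf a q = qpoch a q m * qpoch_inf (a * q ^ m) q"
proof -
  have "(\<lambda>n. qpoch a q (m + n)) \<longlonglongrightarrow> qpoch a q m * qpoch_inf (a * q ^ m) q"
    unfolding qpoch_add by (intro tendsto_mult_fps tendsto_const qpoch_LIMSEQ assms)
  moreover have "(\<lambda>n. qpoch a q (m + n)) \<longlonglongrightarrow> qpoch_inf a q"
    using LIMSEQ_ignore_initial_segment[OF qpoch_LIMSEQ[OF assms], of a m] by (simp add: add.commute)
  ultimately show ?thesis by (rule LIMSEQ_unique[rotated])
qed

lemma qpoch_inf_nth_0: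
  fixes a q :: "'a::field_char_0 fps"
  assumes "q $ 0 = 0" "a $ 0 = 0"
  shows "qpoch_inf a q $ 0 = 1"
proof -
  have "eventually (\<lambda>n. qpoch a q n $ 0 = qpoch_inf a q $ 0) sequentially"
    using qpoch_LIMSEQ[OF assms(1), of a] by (simp add: tendsto_fps_iff)
  then show ?thesis using assms by (simp add: qpoch_nth_0)
qed

text \<open>\<open>qbinomial q m d\<close> is the Gaussian binomial coefficient \<open>m + d\<close> choose \<open>m\<close>.
  Indexing it by \<open>m\<close> and \<open>d\<close> avoids truncated subtraction.\<close>

fun qbinomial :: "'a::comm_ring_1 \<Rightarrow> nat \<Rightarrow> nat \<Rightarrow> 'a" where
  "qbinomial q 0 d = 1"
| "qbinomial q (Suc m) 0 = 1"
| "qbinomial q (Suc m) (Suc d) = qbinomial q m (Suc d) + q ^ Suc m * qbinomial q (Suc m) d"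

lemma qbinomial_0_right [simp]: "qbinomial q m 0 = 1"
  by (cases m) auto

text \<open>The q-factorial formula for Gaussian binomials, with denominators cleared so that it
  makes sense in any commutative ring.\<close>

lemma qbinomial_qpoch:
  "qbinomial q m d * (qpoch q q m * qpoch q q d) = qpoch q q (m + d)"
proof (induction q m d rule: qbinomial.induct)
  case (3 q m d)
  have "qbinomial q (Suc m) (Suc d) * (qpoch q q (Suc m) * qpoch q q (Suc d))
      = (1 - q ^ Suc m) * (qbinomial q m (Suc d) * (qpoch q q m * qpoch q q (Suc d)))
        + q ^ Suc m * (1 - q ^ Suc d) * (qbinomial q (Suc m) d * (qpoch q q (Suc m) * qpoch q q d))"
    by (simp add: qpoch_Suc algebra_simps)
  also have "\<dots> = (1 - q ^ (Suc m + Suc d)) * qpoch q q (Suc (m + d))"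
    unfolding 3 by (simp add: algebra_simps power_add)
  finally show ?case by (simp add: qpoch_Suc algebra_simps)
qed auto

lemma qpoch_neq_0: "q $ 0 = 0 \<Longrightarrow> a $ 0 = 0 \<Longrightarrow> qpoch a q n \<noteq> 0"
  for a q :: "'a::comm_ring_1 fps"
  using qpoch_nth_0[of q a n] by auto

text \<open>The second q-Pascal rule. Both rules agree after multiplication by q-factorials, which
  are nonzero power series and can be cancelled.\<close>

lemma qbinomial_Suc_Suc':
  fixes q :: "'a::idom fps"
  assumes "q $ 0 = 0"
  shows "qbinomial q (Suc m) (Suc d)
       = q ^ Suc d * qbinomial q m (Suc d) + qbinomial q (Suc m) d"
proof -
  have "(q ^ Suc d * qbinomial q m (Suc d) + qbinomial q (Suc m) d)
          * (qpoch q q (Suc m) * qpoch q q (Suc d))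
      = q ^ Suc d * (1 - q ^ Suc m) * (qbinomial q m (Suc d) * (qpoch q q m * qpoch q q (Suc d)))
        + (1 - q ^ Suc d) * (qbinomial q (Suc m) d * (qpoch q q (Suc m) * qpoch q q d))"
    by (simp add: qpoch_Suc algebra_simps)
  also have "\<dots> = (1 - q ^ (Suc m + Suc d)) * qpoch q q (Suc (m + d))"
    unfolding qbinomial_qpoch by (simp add: algebra_simps power_add)
  also have "\<dots> = qbinomial q (Suc m) (Suc d) * (qpoch q q (Suc m) * qpoch q q (Suc d))"
    unfolding qbinomial_qpoch by (simp add: qpoch_Suc algebra_simps)
  finally show ?thesis
    using qpoch_neq_0[OF assms assms] by (auto simp del: qbinomial.simps)
qed

text \<open>In the q-factorial formula the factors \<open>qpoch q q (m + d)\<close> and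
  \<open>qpoch q q d\<close> have the same limit, so only \<open>qpoch q q m\<close>
  remains.\<close>

lemma qbinomial_LIMSEQ:
  fixes q :: "'a::field_char_0 fps"
  assumes "q $ 0 = 0"
  shows "qbinomial q m \<longlonglongrightarrow> inverse (qpoch q q m)"
proof -
  have unit: "qpoch q q n * inverse (qpoch q q n) = 1" for n
    using assms by (intro inverse_mult_eq_1') (simp add: qpoch_nth_0)
  have eq: "qbinomial q m d = qpoch q q (d + m) * (inverse (qpoch q q m) * inverse (qpoch q q d))" for d
  proof -
    have "qpoch q q (d + m) * (inverse (qpoch q q m) * inverse (qpoch q q d))
        = qbinomial q m d * (qpoch q q m * inverse (qpoch q q m))
            * (qpoch q q d * inverse (qpoch q q d))"
      unfolding add.commute[of d m] qbinomial_qpoch[symmetric] by (simp only: mult_ac)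
    then show ?thesis by (simp add: unit)
  qed
  have "(\<lambda>d. qpoch q q (d + m) * (inverse (qpoch q q m) * inverse (qpoch q q d))) \<longlonglongrightarrow>
      qpoch_inf q q * (inverse (qpoch q q m) * inverse (qpoch_inf q q))"
    by (intro tendsto_mult_fps tendsto_const tendsto_inverse_fps qpoch_LIMSEQ
        LIMSEQ_ignore_initial_segment assms) (simp add: qpoch_inf_nth_0 assms)
  also have "qpoch_inf q q * (inverse (qpoch q q m) * inverse (qpoch_inf q q)) =
      inverse (qpoch q q m) * (qpoch_inf q q * inverse (qpoch_inf q q))"
    by (simp add: mult_ac)
  also have "qpoch_inf q q * inverse (qpoch_inf q q) = 1"
    by (intro inverse_mult_eq_1') (simp add: qpoch_inf_nth_0 assms)
  finally show ?thesis unfolding eq[abs_def] by simp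
qed

lemma Suc_choose_two: "Suc m choose 2 = m + (m choose 2)"
  by (simp add: numeral_2_eq_2)

lemma less_choose_two: "Suc d < m \<Longrightarrow> d < m choose 2"
proof (induction m)
  case (Suc m)
  then show ?case by (cases "m = Suc d") (auto simp: Suc_choose_two)
qed auto

text \<open>The finite q-binomial theorem. Appending the factor \<open>1 + z * q ^ n\<close> acts on
  the coefficients by the second q-Pascal rule.\<close>

lemma qpoch_expand:
  fixes q z :: "'a::idom fps"
  assumes "q $ 0 = 0"
  shows "qpoch (- z) q n =
    (\<Sum>m\<le>n. z ^ m * q ^ (m choose 2) * qbinomial q m (n - m))"
proof -
  define e where "e n m = (if m \<le> n then z ^ m * q ^ (m choose 2) * qbinomial q m (n - m) else 0)"
    for n m
  have e0: "e n 0 = 1" for n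
    by (simp add: e_def numeral_2_eq_2)
  have e1: "e (Suc n) (Suc m) = e n (Suc m) + z * q ^ n * e n m" if "m \<le> n" for n m
  proof (cases "m = n")
    case True
    then show ?thesis by (simp add: e_def Suc_choose_two power_add)
  next
    case False
    with that obtain d where n: "n = m + Suc d"
      using less_imp_Suc_add by force
    show ?thesis
      unfolding n e_def using qbinomial_Suc_Suc'[OF assms, of m d]
      by (simp add: Suc_choose_two power_add algebra_simps del: qbinomial.simps)
  qed
  have "qpoch (- z) q n = (\<Sum>m\<le>n. e n m)" for n
  proof (induction n)
    case 0
    then show ?case by (simp add: e0)
  next
    case (Suc n)
    have "(\<Sum>m\<le>Suc n. e (Suc n) m) = 1 + (\<Sum>m\<le>n. e (Suc n) (Suc m))"
      by (subst sum.atMost_Suc_shift) (simp add: e0)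
    also have "\<dots> = (1 + (\<Sum>m\<le>n. e n (Suc m))) + z * q ^ n * (\<Sum>m\<le>n. e n m)"
      by (simp add: e1 sum.distrib sum_distrib_left)
    also have "1 + (\<Sum>m\<le>n. e n (Suc m)) = (\<Sum>m\<le>Suc n. e n m)"
      by (subst sum.atMost_Suc_shift) (simp add: e0)
    also have "\<dots> = (\<Sum>m\<le>n. e n m)"
      by (simp add: e_def)
    finally show ?case by (simp add: Suc.IH qpoch_Suc algebra_simps)
  qed
  then show ?thesis by (simp add: e_def cong: sum.cong_simp)
qed

text \<open>The limit of the finite q-binomial theorem. The exponent \<open>m choose 2\<close> grows
  faster than \<open>m\<close>, so coefficient \<open>d\<close> involves only
  \<open>m \<le> d + 1\<close> and the limit may be taken termwise.\<close>

lemma euler_sums: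
  fixes q z :: "'a::field_char_0 fps"
  assumes "q $ 0 = 0"
  shows "(\<lambda>m. z ^ m * q ^ (m choose 2) * inverse (qpoch q q m)) sums qpoch_inf (- z) q"
proof -
  define e where "e n m = (if m \<le> n then z ^ m * q ^ (m choose 2) * qbinomial q m (n - m) else 0)"
    for n m
  define f where "f m = z ^ m * q ^ (m choose 2) * inverse (qpoch q q m)" for m
  have ord: "(q ^ (m choose 2) * h) $ d = 0" if "Suc d < m" for m d and h :: "'a fps"
    by (rule fps_nth_mult_power_eq_0) (use assms less_choose_two[OF that] in auto)
  have "f m $ d = 0" if "Suc d < m" for m d
    using ord[OF that, of "z ^ m * inverse (qpoch q q m)"] by (simp add: f_def mult_ac)
  then have "summable f" by (rule summable_fps)
  then obtain S where S: "f sums S" by (auto simp: summable_def)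
  have lim: "(\<lambda>n. e n m) \<longlonglongrightarrow> f m" for m
  proof (rule LIMSEQ_offset[where k = m])
    show "(\<lambda>n. e (n + m) m) \<longlonglongrightarrow> f m"
      unfolding e_def f_def
      by (simp add: tendsto_mult_fps qbinomial_LIMSEQ[OF assms])
  qed
  have "(\<lambda>n. \<Sum>m<Suc n. e n m) \<longlonglongrightarrow> S"
  proof (rule tendsto_sum_fps_dominated[where g = Suc, OF lim _ filterlim_Suc S])
    show "e n m $ d = 0" if "Suc d < m" for n m d
      using ord[OF that, of "z ^ m * qbinomial q m (n - m)"] by (simp add: e_def mult_ac)
  qed
  moreover have "(\<Sum>m<Suc n. e n m) = qpoch (- z) q n" for n
    by (simp add: qpoch_expand[OF assms] e_def lessThan_Suc_atMost cong: sum.cong_simp)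
  ultimately have "qpoch (- z) q \<longlonglongrightarrow> S" by simp
  then have "S = qpoch_inf (- z) q"
    using LIMSEQ_unique qpoch_LIMSEQ[OF assms] by blast
  with S show ?thesis by (simp add: f_def[abs_def])
qed

section \<open>Sums over binary words\<close>

lemma sum_Pow_lessThan_Suc:
  "(\<Sum>W\<in>Pow {..<Suc n}. h W) = (\<Sum>W\<in>Pow {..<n}. h W + h (insert n W))"
  for h :: "nat set \<Rightarrow> 'a::comm_monoid_add"
proof -
  have "(\<Sum>W\<in>Pow {..<Suc n}. h W)
      = (\<Sum>W\<in>Pow {..<n}. h W) + (\<Sum>W\<in>insert n ` Pow {..<n}. h W)"
    unfolding lessThan_Suc Pow_insert by (rule sum.union_disjoint) auto
  also have "(\<Sum>W\<in>insert n ` Pow {..<n}. h W) = (\<Sum>W\<in>Pow {..<n}. h (insert n W))"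
    by (subst sum.reindex) (auto intro!: inj_onI simp: o_def)
  finally show ?thesis by (simp add: sum.distrib)
qed

lemma prod_lessThan_add:
  "(\<Prod>j<m + n. f j) = (\<Prod>j<m. f j) * (\<Prod>j<n. f (m + j))"
  for f :: "nat \<Rightarrow> 'a::comm_monoid_mult"
  by (induction n) (simp_all add: mult_ac)

text \<open>An occupied position \<open>0\<close> is not counted, as if the position before it were occupied.\<close>

definition ascents :: "nat set \<Rightarrow> nat" where
  "ascents W = card {j. j \<notin> W \<and> Suc j \<in> W}"

lemma ascents_insert:
  assumes "W \<subseteq> {..<Suc n}"
  shows "ascents (insert (Suc n) W) = (if n \<in> W then ascents W else Suc (ascents W))"
proof -
  have fin: "finite {j. j \<notin> W \<and> Suc j \<in> W}"
    by (rule finite_subset[of _ "{..<Suc n}"]) (use assms in auto)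
  have "{j. j \<notin> insert (Suc n) W \<and> Suc j \<in> insert (Suc n) W}
      = (if n \<in> W then {j. j \<notin> W \<and> Suc j \<in> W} else insert n {j. j \<notin> W \<and> Suc j \<in> W})"
    using assms by auto
  moreover have "n \<notin> {j. j \<notin> W \<and> Suc j \<in> W}"
    using assms by auto
  ultimately show ?thesis
    using card_insert_disjoint[OF fin] by (cases "n \<in> W") (simp_all only: ascents_def if_True if_False)
qed

definition word_sum :: "'a::comm_ring_1 \<Rightarrow> (nat \<Rightarrow> 'a) \<Rightarrow> (nat \<Rightarrow> 'a) \<Rightarrow> nat \<Rightarrow> 'a" where
  "word_sum y u v n =
     (\<Sum>W\<in>Pow {..<n}. y ^ ascents W * (\<Prod>j<n. if j \<in> W then u j else v j))"

lemma word_sum_0: "word_sum y u v 0 = 1"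
  by (simp add: word_sum_def ascents_def)

lemma word_sum_1: "word_sum y u v (Suc 0) = u 0 + v 0"
  unfolding word_sum_def by (subst sum_Pow_lessThan_Suc) (simp add: ascents_def)

text \<open>Expanding \<open>(1 - a) ^ ascents W\<close> in powers of \<open>- a\<close> marks some of the ascents. Each marked
  ascent is a domino covering two positions, all other positions are free: this is the recurrence of
  a continuant.\<close>

lemma word_sum_Suc_Suc:
  "word_sum (1 - a) u v (Suc (Suc n))
     = (v (Suc n) + u (Suc n)) * word_sum (1 - a) u v (Suc n)
       - a * u (Suc n) * v n * word_sum (1 - a) u v n"
proof -
  define g where "g n W = (1 - a) ^ ascents W * (\<Prod>j<n. if j \<in> W then u j else v j)" for n W
  have g1: "g (Suc (Suc n)) W = v (Suc n) * g (Suc n) W" if "W \<subseteq> {..<Suc n}" for W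
    using that by (auto simp: g_def mult_ac)
  have g2: "g (Suc (Suc n)) (insert (Suc n) W)
      = (if n \<in> W then u (Suc n) * g (Suc n) W else (1 - a) * u (Suc n) * g (Suc n) W)"
    if "W \<subseteq> {..<Suc n}" for W
  proof -
    have "(\<Prod>j<Suc n. if j \<in> insert (Suc n) W then u j else v j)
        = (\<Prod>j<Suc n. if j \<in> W then u j else v j)"
      by (intro prod.cong) auto
    then show ?thesis
      unfolding g_def ascents_insert[OF that] prod.lessThan_Suc[of _ "Suc n"] by (auto simp: mult_ac)
  qed
  have g3: "g (Suc n) W = v n * g n W" if "W \<subseteq> {..<n}" for W
    using that by (auto simp: g_def mult_ac)
  have ws: "word_sum (1 - a) u v n = (\<Sum>W\<in>Pow {..<n}. g n W)" for n
    by (simp add: word_sum_def g_def)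
  have "word_sum (1 - a) u v (Suc (Suc n))
      = (\<Sum>W\<in>Pow {..<Suc n}. v (Suc n) * g (Suc n) W
          + (if n \<in> W then u (Suc n) * g (Suc n) W else (1 - a) * u (Suc n) * g (Suc n) W))"
    unfolding ws sum_Pow_lessThan_Suc[of _ "Suc n"] by (intro sum.cong) (auto simp: g1 g2)
  \<comment> \<open>With \<open>u\<close> extracted in both cases, the correction \<open>- a\<close>
    is left only for words with position \<open>n\<close> empty. Such words are words on
    \<open>n\<close> positions with a factor \<open>v n\<close>, the empty end of the
    domino.\<close>
  also have "\<dots> = (\<Sum>W\<in>Pow {..<Suc n}. (v (Suc n) + u (Suc n)) * g (Suc n) W
          - (if n \<in> W then 0 else a * u (Suc n) * g (Suc n) W))"
    by (intro sum.cong) (auto simp: algebra_simps)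
  also have "\<dots> = (v (Suc n) + u (Suc n)) * word_sum (1 - a) u v (Suc n)
      - (\<Sum>W\<in>Pow {..<Suc n}. if n \<in> W then 0 else a * u (Suc n) * g (Suc n) W)"
    by (simp only: sum_subtractf ws sum_distrib_left)
  also have "(\<Sum>W\<in>Pow {..<Suc n}. if n \<in> W then 0 else a * u (Suc n) * g (Suc n) W)
      = (\<Sum>W\<in>Pow {..<n}. a * u (Suc n) * v n * g n W)"
    unfolding sum_Pow_lessThan_Suc by (intro sum.cong) (auto simp: g3 mult_ac)
  finally show ?thesis
    by (simp add: ws sum_distrib_left)
qed

text \<open>Each word takes exactly one weight at each position, so only the ratio of the two
  weights there matters. This freedom turns the weights of a two-sided window into a geometric
  progression.\<close>

lemma word_sum_scale:
  "word_sum y (\<lambda>j. s j * u j) (\<lambda>j. s j * v j) n = (\<Prod>j<n. s j) * word_sum y u v n"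
proof -
  have "(\<Prod>j<n. if j \<in> W then s j * u j else s j * v j)
      = (\<Prod>j<n. s j) * (\<Prod>j<n. if j \<in> W then u j else v j)" for W
    unfolding prod.distrib[symmetric] by (intro prod.cong) auto
  then show ?thesis
    by (simp add: word_sum_def sum_distrib_left mult_ac)
qed

lemma word_sum_cong:
  "(\<And>j. j < n \<Longrightarrow> u j = u' j) \<Longrightarrow> (\<And>j. j < n \<Longrightarrow> v j = v' j) \<Longrightarrow>
    word_sum y u v n = word_sum y u' v' n"
  unfolding word_sum_def by (intro sum.cong arg_cong2[of _ _ _ _ "(*)"] prod.cong) auto

text \<open>The contribution of all placements of \<open>m\<close> dominoes on \<open>n\<close> positions when position \<open>j\<close> has
  weight \<open>z * q ^ j\<close> if occupied and \<open>b\<close> if empty.\<close>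

definition domino_term :: "'a::comm_ring_1 \<Rightarrow> 'a \<Rightarrow> 'a \<Rightarrow> 'a \<Rightarrow> nat \<Rightarrow> nat \<Rightarrow> 'a" where
  "domino_term a z b q n m =
     (if 2 * m \<le> n then (- a * z * b) ^ m * q ^ (m * m) * qbinomial q m (n - 2 * m)
        * (\<Prod>j<n - 2 * m. b + z * q ^ (m + j)) else 0)"

text \<open>The continuant recurrence, refined by the number of dominoes. In the closed form,
  \<open>m * m = 1 + 3 + ... + (2 * m - 1)\<close> collects the occupied ends of \<open>m\<close>
  dominoes packed from position 0.\<close>

lemma domino_term_Suc_Suc:
  fixes q :: "'a::idom fps"
  assumes "q $ 0 = 0"
  shows "domino_term a z b q (Suc (Suc n)) (Suc m)
      = (b + z * q ^ Suc n) * domino_term a z b q (Suc n) (Suc m)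
        - a * (z * q ^ Suc n) * b * domino_term a z b q n m"
proof -
  consider "n < 2 * m" | "n = 2 * m" | e where "n = 2 * m + Suc e"
    by (metis less_imp_Suc_add linorder_neqE_nat add_Suc_right)
  then show ?thesis
  proof cases
    case 1
    then show ?thesis by (simp add: domino_term_def)
  next
    case 2
    then show ?thesis
      by (simp add: domino_term_def power_add mult_ac mult_2_right)
  next
    case 3
    define P where "P = (\<Prod>j<e. b + z * q ^ (Suc m + j))"
    have P1: "(\<Prod>j<Suc e. b + z * q ^ (Suc m + j)) = P * (b + z * q ^ (Suc m + e))"
      by (simp add: P_def)
    have P2: "(\<Prod>j<Suc e. b + z * q ^ (m + j)) = (b + z * q ^ m) * P"
      by (subst prod.lessThan_Suc_shift) (simp add: P_def)
    let ?B = "qbinomial q (Suc m) (Suc e)"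
    have B1: "?B = qbinomial q m (Suc e) + q ^ Suc m * qbinomial q (Suc m) e" by simp
    have B2: "?B = q ^ Suc e * qbinomial q m (Suc e) + qbinomial q (Suc m) e"
      by (rule qbinomial_Suc_Suc'[OF assms])
    \<comment> \<open>Neither q-Pascal rule suffices alone: the part with \<open>b\<close> takes the
      second rule, the part with \<open>z\<close> the first.\<close>
    have key: "?B * (b + z * q ^ (Suc m + e)) =
        (b + z * q ^ (Suc (Suc (2 * m + e)))) * qbinomial q (Suc m) e
          + q ^ Suc e * qbinomial q m (Suc e) * (b + z * q ^ m)"
    proof -
      have "?B * (b + z * q ^ (Suc m + e)) = b * ?B + z * q ^ (Suc m + e) * ?B"
        by (simp add: algebra_simps)
      also have "b * ?B = b * (q ^ Suc e * qbinomial q m (Suc e) + qbinomial q (Suc m) e)"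
        by (simp only: B2)
      also have "z * q ^ (Suc m + e) * ?B
          = z * q ^ (Suc m + e) * (qbinomial q m (Suc e) + q ^ Suc m * qbinomial q (Suc m) e)"
        by (simp only: B1)
      finally show ?thesis
        by (simp add: algebra_simps power_add mult_2_right del: qbinomial.simps)
    qed
    have n: "n - 2 * m = Suc e" "Suc n - 2 * Suc m = e" "Suc (Suc n) - 2 * Suc m = Suc e"
      "2 * m \<le> n" "2 * Suc m \<le> Suc n" "2 * Suc m \<le> Suc (Suc n)"
      using 3 by auto
    have "domino_term a z b q (Suc (Suc n)) (Suc m)
        = (- a * z * b) ^ Suc m * q ^ (Suc m * Suc m) * P * (?B * (b + z * q ^ (Suc m + e)))"
      unfolding domino_term_def n P1 using n by (simp only: if_True mult_ac)
    also have "\<dots> = (b + z * q ^ Suc n) * ((- a * z * b) ^ Suc m * q ^ (Suc m * Suc m)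
          * qbinomial q (Suc m) e * P)
        - a * (z * q ^ Suc n) * b * ((- a * z * b) ^ m * q ^ (m * m)
          * qbinomial q m (Suc e) * ((b + z * q ^ m) * P))"
      unfolding key 3 by (simp add: algebra_simps power_add mult_2_right del: qbinomial.simps)
    also have "\<dots> = (b + z * q ^ Suc n) * domino_term a z b q (Suc n) (Suc m)
        - a * (z * q ^ Suc n) * b * domino_term a z b q n m"
      unfolding domino_term_def n P2 using n by (simp only: if_True P_def)
    finally show ?thesis .
  qed
qed

lemma word_sum_geometric:
  fixes q :: "'a::idom fps"
  assumes "q $ 0 = 0"
  shows "word_sum (1 - a) (\<lambda>j. z * q ^ j) (\<lambda>_. b) n = (\<Sum>m\<le>n. domino_term a z b q n m)"
proof (induction n rule: induct_nat_012)
  case 0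
  then show ?case by (simp add: word_sum_0 domino_term_def)
next
  case 1
  then show ?case by (simp add: word_sum_1 domino_term_def)
next
  case (ge2 n)
  let ?T = "domino_term a z b q"
  have T0: "?T (Suc n) 0 = (b + z * q ^ n) * ?T n 0" for n
    by (simp add: domino_term_def mult_ac)
  have T1: "(\<Sum>m\<le>Suc n. ?T n m) = (\<Sum>m\<le>n. ?T n m)" for n
    by (simp add: domino_term_def)
  have "(\<Sum>m\<le>Suc (Suc n). ?T (Suc (Suc n)) m)
      = ?T (Suc (Suc n)) 0 + (\<Sum>m\<le>Suc n. ?T (Suc (Suc n)) (Suc m))"
    by (rule sum.atMost_Suc_shift)
  also have "\<dots> = (b + z * q ^ Suc n) * (?T (Suc n) 0 + (\<Sum>m\<le>Suc n. ?T (Suc n) (Suc m)))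
      - a * (z * q ^ Suc n) * b * (\<Sum>m\<le>Suc n. ?T n m)"
    unfolding T0[of "Suc n"] domino_term_Suc_Suc[OF assms]
    by (simp only: sum_subtractf sum_distrib_left ring_distribs add_diff_eq)
  also have "?T (Suc n) 0 + (\<Sum>m\<le>Suc n. ?T (Suc n) (Suc m)) = (\<Sum>m\<le>Suc (Suc n). ?T (Suc n) m)"
    by (rule sum.atMost_Suc_shift[symmetric])
  finally show ?case
    unfolding word_sum_Suc_Suc T1 ge2 by simp
qed

section \<open>Limits of word sums, two-sided and one-sided\<close>

lemma choose_two_add: "(m + k) choose 2 = (m choose 2) + (k choose 2) + m * k"
  by (induction k) (simp_all add: Suc_choose_two binomial_eq_0)

lemma square_eq_choose_two: "m * m = m + 2 * (m choose 2)"
  by (induction m) (simp_all add: Suc_choose_two)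

lemma prod_geometric: "(\<Prod>j<k. z * q ^ j) = z ^ k * q ^ (k choose 2)"
  for z q :: "'a::comm_semiring_1"
  by (induction k) (simp_all add: Suc_choose_two power_add mult_ac binomial_eq_0)

text \<open>Folding a product at its centre, as in the finite Jacobi triple product. Left of the
  centre \<open>z * q ^ j\<close> is extracted, and \<open>z * z' = q\<close> leaves the factors of
  \<open>qpoch (- z') q k\<close> in reverse order; right of it \<open>q ^ k\<close> is
  extracted.\<close>

lemma prod_centre:
  fixes q z z' :: "'a::comm_ring_1"
  assumes "z * z' = q"
  shows "(\<Prod>j<k + k. q ^ k + z * q ^ j)
       = z ^ k * q ^ (k choose 2) * q ^ (k * k) * (qpoch (- z') q k * qpoch (- z) q k)"
proof -
  have "(\<Prod>j<k. q ^ k + z * q ^ j) = (\<Prod>j<k. (z * q ^ j) * (1 + z' * q ^ (k - Suc j)))"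
  proof (rule prod.cong)
    fix j assume "j \<in> {..<k}"
    then have "k = Suc (j + (k - Suc j))" by auto
    then have "q ^ k = q * q ^ j * q ^ (k - Suc j)"
      by (metis power_Suc power_add mult.assoc)
    then show "q ^ k + z * q ^ j = (z * q ^ j) * (1 + z' * q ^ (k - Suc j))"
      unfolding assms[symmetric] by (simp add: algebra_simps)
  qed auto
  also have "\<dots> = z ^ k * q ^ (k choose 2) * (\<Prod>j<k. 1 + z' * q ^ (k - Suc j))"
    by (subst prod.distrib) (simp only: prod_geometric)
  also have "(\<Prod>j<k. 1 + z' * q ^ (k - Suc j)) = qpoch (- z') q k"
    unfolding qpoch_def by (subst prod.nat_diff_reindex) simp
  finally have "(\<Prod>j<k. q ^ k + z * q ^ j) = z ^ k * q ^ (k choose 2) * qpoch (- z') q k" .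
  moreover have "(\<Prod>j<k. q ^ k + z * q ^ (k + j)) = q ^ (k * k) * qpoch (- z) q k"
  proof -
    have "(\<Prod>j<k. q ^ k + z * q ^ (k + j)) = (\<Prod>j<k. q ^ k * (1 + z * q ^ j))"
      by (intro prod.cong) (auto simp: algebra_simps power_add)
    then show ?thesis by (simp add: prod.distrib qpoch_def power_mult)
  qed
  ultimately show ?thesis
    unfolding prod_lessThan_add by (simp add: mult_ac)
qed

text \<open>A window of \<open>2 * M\<close> positions in a two-sided infinite word that is eventually occupied on
  the left and eventually empty on the right; position \<open>j\<close> of the window is the integer \<open>j - M\<close>.\<close>

lemma word_sum_bilateral:
  fixes q z z' :: "'a::idom fps"
  assumes q: "q $ 0 = 0" "q \<noteq> 0" "z \<noteq> 0" and zz': "z * z' = q"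
  shows "word_sum (1 - a) (\<lambda>j. if j < M then 1 else z * q ^ (j - M))
           (\<lambda>j. if j < M then z' * q ^ (M - Suc j) else 1) (2 * M)
       = (\<Sum>m\<le>M. (- a) ^ m * q ^ (Suc m choose 2) * qbinomial q m (2 * (M - m))
            * (qpoch (- z') q (M - m) * qpoch (- z) q (M - m)))"
    (is "?W = ?R")
proof -
  \<comment> \<open>This scaling makes the occupied weight \<open>z * q ^ j\<close> and the empty
    weight \<open>q ^ M\<close> throughout the window, so the domino formula applies with
    \<open>b = q ^ M\<close>. It is cancelled at the end, since \<open>z\<close> and
    \<open>q\<close> are nonzero.\<close>
  define s where "s j = (if j < M then z * q ^ j else q ^ M)" for j
  have s: "(\<Prod>j<2 * M. s j) = z ^ M * q ^ (M choose 2) * q ^ (M * M)"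
    unfolding mult_2 prod_lessThan_add by (simp add: s_def prod_geometric power_mult)
  have "(\<Prod>j<2 * M. s j) * ?W = word_sum (1 - a) (\<lambda>j. z * q ^ j) (\<lambda>_. q ^ M) (2 * M)"
    unfolding word_sum_scale[symmetric]
  proof (rule word_sum_cong)
    fix j
    show "s j * (if j < M then 1 else z * q ^ (j - M)) = z * q ^ j"
      by (auto simp: s_def mult_ac simp flip: power_add)
    show "s j * (if j < M then z' * q ^ (M - Suc j) else 1) = q ^ M"
    proof (cases "j < M")
      case True
      then have "M = Suc (j + (M - Suc j))" by auto
      then have "q ^ M = q * q ^ j * q ^ (M - Suc j)"
        by (metis power_Suc power_add mult.assoc)
      with True show ?thesis by (simp add: s_def mult_ac flip: zz')
    qed (simp add: s_def)
  qed
  also have "\<dots> = (\<Sum>m\<le>2 * M. domino_term a z (q ^ M) q (2 * M) m)"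
    by (rule word_sum_geometric[OF q(1)])
  also have "\<dots> = (\<Sum>m\<le>M. domino_term a z (q ^ M) q (2 * M) m)"
    by (intro sum.mono_neutral_right) (auto simp: domino_term_def)
  also have "\<dots> = (\<Prod>j<2 * M. s j) * ?R"
    unfolding sum_distrib_left
  proof (rule sum.cong)
    fix m assume "m \<in> {..M}"
    then obtain k where M: "M = m + k" by (auto simp: le_iff_add)
    let ?B = "qbinomial q m (2 * k)" and ?P = "qpoch (- z') q k * qpoch (- z) q k"
    have "(\<Prod>j<2 * k. q ^ M + z * q ^ (m + j)) = (\<Prod>j<k + k. q ^ m * (q ^ k + z * q ^ j))"
      unfolding mult_2 by (intro prod.cong) (auto simp: M power_add algebra_simps)
    also have "\<dots> = q ^ (m * (2 * k)) * (z ^ k * q ^ (k choose 2) * q ^ (k * k) * ?P)"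
      by (simp add: prod.distrib prod_centre[OF zz'] power_mult mult_2)
    finally have centre: "(\<Prod>j<2 * k. q ^ M + z * q ^ (m + j))
        = q ^ (m * (2 * k)) * (z ^ k * q ^ (k choose 2) * q ^ (k * k) * ?P)" .
    have "domino_term a z (q ^ M) q (2 * M) m
        = (- a * z * q ^ M) ^ m * q ^ (m * m) * ?B * (\<Prod>j<2 * k. q ^ M + z * q ^ (m + j))"
      by (simp add: domino_term_def M)
    also have "\<dots> = (- a) ^ m * ?B * ?P * (z ^ m * z ^ k)
          * (q ^ (M * m) * q ^ (m * m) * q ^ (m * (2 * k)) * q ^ (k choose 2) * q ^ (k * k))"
      unfolding centre power_mult_distrib power_mult[of q M m, symmetric] by (simp only: mult_ac)
    also have "q ^ (M * m) * q ^ (m * m) * q ^ (m * (2 * k)) * q ^ (k choose 2) * q ^ (k * k)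
        = q ^ (M * m + m * m + m * (2 * k) + (k choose 2) + k * k)"
      by (simp only: power_add)
    \<comment> \<open>Beyond the exponent of the scaling factor only \<open>Suc m choose 2\<close>
      is left, which does not depend on \<open>M\<close>; this is what permits the limit.\<close>
    also have "M * m + m * m + m * (2 * k) + (k choose 2) + k * k
        = (M choose 2) + M * M + (Suc m choose 2)"
      using square_eq_choose_two[of m] unfolding M choose_two_add Suc_choose_two
      by (simp add: algebra_simps)
    finally show "domino_term a z (q ^ M) q (2 * M) m = (\<Prod>j<2 * M. s j) *
        ((- a) ^ m * q ^ (Suc m choose 2) * qbinomial q m (2 * (M - m))
            * (qpoch (- z') q (M - m) * qpoch (- z) q (M - m)))"
      unfolding s by (simp add: M power_add mult_ac)
  qed auto
  finally show ?thesis
    unfolding s using q by simp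
qed

text \<open>For fixed \<open>m\<close> the two products of length \<open>M - m\<close> tend to a
  constant \<open>C\<close> free of \<open>m\<close>. The sum over \<open>m\<close> decouples from
  it and is Euler's series with argument \<open>- a * q\<close>.\<close>

lemma word_sum_bilateral_LIMSEQ:
  fixes q z z' :: "'a::field_char_0 fps"
  assumes q: "q $ 0 = 0" "q \<noteq> 0" "z \<noteq> 0" and zz': "z * z' = q"
  shows "(\<lambda>M. word_sum (1 - a) (\<lambda>j. if j < M then 1 else z * q ^ (j - M))
           (\<lambda>j. if j < M then z' * q ^ (M - Suc j) else 1) (2 * M))
       \<longlonglongrightarrow> qpoch_inf (a * q) q * (qpoch_inf (- z') q * qpoch_inf (- z) q)"
proof -
  define T where "T M m = (if m \<le> M then (- a) ^ m * q ^ (Suc m choose 2) * qbinomial q m (2 * (M - m))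
            * (qpoch (- z') q (M - m) * qpoch (- z) q (M - m)) else 0)" for M m
  define C where "C = qpoch_inf (- z') q * qpoch_inf (- z) q"
  define T' where "T' m = (- a) ^ m * q ^ (Suc m choose 2) * inverse (qpoch q q m) * C" for m
  have "(\<lambda>m. C * ((- a * q) ^ m * q ^ (m choose 2) * inverse (qpoch q q m)))
      sums (C * qpoch_inf (a * q) q)"
    using sums_mult_fps[OF euler_sums[OF q(1), of "- a * q"], of C] by simp
  also have "(\<lambda>m. C * ((- a * q) ^ m * q ^ (m choose 2) * inverse (qpoch q q m))) = T'"
    unfolding T'_def Suc_choose_two power_add power_mult_distrib by (simp only: mult_ac)
  finally have S: "T' sums (qpoch_inf (a * q) q * C)"
    by (simp only: mult.commute)
  have lim: "(\<lambda>M. T M m) \<longlonglongrightarrow> T' m" for m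
  proof (rule LIMSEQ_offset[where k = m])
    have "(\<lambda>n. qbinomial q m (2 * n)) \<longlonglongrightarrow> inverse (qpoch q q m)"
      using LIMSEQ_subseq_LIMSEQ[OF qbinomial_LIMSEQ[OF q(1), of m], of "(*) 2"]
      by (simp add: strict_mono_def o_def)
    then show "(\<lambda>n. T (n + m) m) \<longlonglongrightarrow> T' m"
      unfolding T_def T'_def C_def
      by (simp, intro tendsto_mult_fps tendsto_const qpoch_LIMSEQ q)
  qed
  have "(\<lambda>M. \<Sum>m<Suc M. T M m) \<longlonglongrightarrow> qpoch_inf (a * q) q * C"
  proof (rule tendsto_sum_fps_dominated[where g = id, OF lim _ filterlim_Suc S])
    show "T M m $ d = 0" if "id d < m" for M m d
      using fps_nth_mult_power_eq_0[OF q(1), of d "Suc m choose 2" "(- a) ^ m * qbinomial q m (2 * (M - m))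
            * (qpoch (- z') q (M - m) * qpoch (- z) q (M - m))"] that
      by (simp add: T_def mult_ac less_choose_two)
  qed
  moreover have "(\<Sum>m<Suc M. T M m) = word_sum (1 - a) (\<lambda>j. if j < M then 1 else z * q ^ (j - M))
           (\<lambda>j. if j < M then z' * q ^ (M - Suc j) else 1) (2 * M)" for M
    unfolding word_sum_bilateral[OF assms] lessThan_Suc_atMost by (simp add: T_def)
  ultimately show ?thesis by (simp add: C_def)
qed

text \<open>The two weights differ by \<open>(1 - x) * z\<close> on words with position 0 occupied.
  Removing that position leaves a word that follows an occupied position, exactly the convention of
  \<open>ascents\<close>, with weights \<open>z * q * q ^ j\<close>.\<close>

lemma word_sum_first:
  "word_sum (1 - a) (\<lambda>j. if j = 0 then x * z else z * q ^ j) (\<lambda>_. 1) (Suc n)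
     = word_sum (1 - a) (\<lambda>j. z * q ^ j) (\<lambda>_. 1) (Suc n)
       - (1 - x) * z * word_sum (1 - a) (\<lambda>j. z * q * q ^ j) (\<lambda>_. 1) n"
proof (induction n rule: induct_nat_012)
  case 0
  then show ?case by (simp add: word_sum_0 word_sum_1 algebra_simps)
next
  case 1
  then show ?case
    by (simp add: word_sum_Suc_Suc[where n = 0] word_sum_0 word_sum_1 algebra_simps)
next
  case (ge2 n)
  show ?case
    unfolding word_sum_Suc_Suc[where n = "Suc n"]
      word_sum_Suc_Suc[where n = n and u = "\<lambda>j. z * q * q ^ j"] ge2
    by (simp add: algebra_simps)
qed

text \<open>With \<open>b = 1\<close> the free positions contribute
  \<open>qpoch_inf (- z * q ^ m) q\<close> in the limit, which is \<open>qpoch_inf (- z) q\<close>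
  divided by \<open>qpoch (- z) q m\<close>.\<close>

lemma word_sum_geometric_LIMSEQ:
  fixes q z :: "'a::field_char_0 fps"
  assumes q: "q $ 0 = 0" and z: "z $ 0 = 0"
    and S: "(\<lambda>m. (- a * z) ^ m * q ^ (m * m) * inverse (qpoch q q m * qpoch (- z) q m)) sums S"
  shows "word_sum (1 - a) (\<lambda>j. z * q ^ j) (\<lambda>_. 1) \<longlonglongrightarrow> qpoch_inf (- z) q * S"
proof -
  define T' where "T' m = (- a * z) ^ m * q ^ (m * m) * inverse (qpoch q q m)
    * qpoch_inf (- z * q ^ m) q" for m
  have T'_eq: "T' m = qpoch_inf (- z) q *
      ((- a * z) ^ m * q ^ (m * m) * inverse (qpoch q q m * qpoch (- z) q m))" for m
  proof -
    have "qpoch_inf (- z) q * inverse (qpoch (- z) q m)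
        = (qpoch (- z) q m * inverse (qpoch (- z) q m)) * qpoch_inf (- z * q ^ m) q"
      unfolding qpoch_inf_split[OF q, of "- z" m] by (simp only: mult_ac)
    also have "qpoch (- z) q m * inverse (qpoch (- z) q m) = 1"
      by (intro inverse_mult_eq_1') (simp add: qpoch_nth_0 q z)
    finally show ?thesis
      unfolding T'_def fps_inverse_mult by (simp add: mult_ac)
  qed
  have T': "T' sums (qpoch_inf (- z) q * S)"
    by (subst sums_cong[OF T'_eq]) (rule sums_mult_fps[OF S])
  have lim: "(\<lambda>n. domino_term a z 1 q n m) \<longlonglongrightarrow> T' m" for m
  proof (rule LIMSEQ_offset[where k = "2 * m"])
    have "(\<Prod>j<d. 1 + z * q ^ (m + j)) = qpoch (- z * q ^ m) q d" for d
      by (simp add: qpoch_def power_add mult_ac)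
    then have "domino_term a z 1 q (n + 2 * m) m =
        (- a * z) ^ m * q ^ (m * m) * qbinomial q m n * qpoch (- z * q ^ m) q n" for n
      by (simp add: domino_term_def)
    then show "(\<lambda>n. domino_term a z 1 q (n + 2 * m) m) \<longlonglongrightarrow> T' m"
      unfolding T'_def
      by (simp only:) (intro tendsto_mult_fps tendsto_const qpoch_LIMSEQ qbinomial_LIMSEQ q)
  qed
  have "(\<lambda>n. \<Sum>m<Suc n. domino_term a z 1 q n m) \<longlonglongrightarrow> qpoch_inf (- z) q * S"
  proof (rule tendsto_sum_fps_dominated[where g = id, OF lim _ filterlim_Suc T'])
    fix n m d :: nat assume "id d < m"
    then have "d < m * m" by (cases m) auto
    then have "(q ^ (m * m) * ((- a * z * 1) ^ m * qbinomial q m (n - 2 * m) *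
        (\<Prod>j<n - 2 * m. 1 + z * q ^ (m + j)))) $ d = 0"
      by (rule fps_nth_mult_power_eq_0[OF q])
    then show "domino_term a z 1 q n m $ d = 0"
      unfolding domino_term_def by (simp only: mult_ac split: if_split) simp
  qed
  then show ?thesis
    unfolding word_sum_geometric[OF q, of a z 1, abs_def] lessThan_Suc_atMost .
qed

text \<open>The terms of \<open>SA\<close> and \<open>SL\<close> differ by a factor
  \<open>q ^ m\<close>, since \<open>m * m = 2 * (m choose 2) + m\<close>. Their difference is
  therefore a multiple of the series \<open>S\<close> belonging to \<open>z * q\<close>, the
  correction for the first position. Substituting for \<open>S\<close> leaves
  \<open>SA + x * SL\<close>; the factor \<open>1 + x\<close> supplies the missing part of
  \<open>a\<close>.\<close>

lemma word_sum_first_LIMSEQ: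
  fixes q z x a :: "'a::field_char_0 fps"
  assumes q: "q $ 0 = 0" and z: "z $ 0 = 0" and a: "a = (1 - x) * (1 + x)"
    and SA: "(\<lambda>m. (- a * z) ^ m * q ^ (2 * (m choose 2))
        * inverse (qpoch q q m * qpoch (- z) q m)) sums SA"
    and SL: "(\<lambda>m. (- a * z) ^ m * q ^ (m * m)
        * inverse (qpoch q q m * qpoch (- z) q m)) sums SL"
  shows "(\<lambda>n. (1 + x) * word_sum (1 - a) (\<lambda>j. if j = 0 then x * z else z * q ^ j) (\<lambda>_. 1) (Suc n))
    \<longlonglongrightarrow> qpoch_inf (- z) q * (SA + x * SL)"
proof -
  define G where "G = inverse (1 + z)"
  define f where "f m = (- a * (z * q)) ^ m * q ^ (m * m)
    * inverse (qpoch q q m * qpoch (- (z * q)) q m)" for m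
  have zq: "(z * q) $ 0 = 0" using z by simp
  have G: "(1 + z) * G = 1"
    unfolding G_def by (intro inverse_mult_eq_1') (simp add: z)
  have "summable f"
  proof (rule summable_fps[where g = id])
    fix m d :: nat assume "id d < m"
    then have "d < m * m" by (cases m) auto
    then have "(q ^ (m * m) * ((- a * (z * q)) ^ m * inverse (qpoch q q m * qpoch (- (z * q)) q m))) $ d = 0"
      by (rule fps_nth_mult_power_eq_0[OF q])
    then show "f m $ d = 0"
      by (simp only: f_def mult_ac)
  qed
  then obtain S where S: "f sums S" by (auto simp: summable_def)
  define A where "A m = (- a * z) ^ m * q ^ (2 * (m choose 2))
        * inverse (qpoch q q m * qpoch (- z) q m)" for m
  define L where "L m = (- a * z) ^ m * q ^ (m * m)
        * inverse (qpoch q q m * qpoch (- z) q m)" for m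
  have AL0: "A 0 = L 0" by (simp add: A_def L_def binomial_eq_0)
  \<comment> \<open>The difference of the two terms contains \<open>1 - q ^ Suc m\<close>, the last
    factor of \<open>qpoch q q (Suc m)\<close>. Cancelling it lowers the index, and the first factor
    \<open>1 + z\<close> of the other denominator splits off as \<open>G\<close>.\<close>
  have AL: "A (Suc m) = L (Suc m) - a * z * G * f m" for m
  proof -
    define K where "K = (- a * z) ^ Suc m * q ^ (m + m * m) * G * inverse (qpoch (- (z * q)) q m)"
    define I where "I = inverse (qpoch q q (Suc m))"
    have "inverse (1 - q * q ^ m) * (1 - q * q ^ m) = 1"
      by (intro inverse_mult_eq_1) (simp add: q)
    then have I: "inverse (qpoch q q m) = I * (1 - q * q ^ m)"
      unfolding I_def qpoch_Suc fps_inverse_mult by (simp add: mult.assoc)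
    have J: "inverse (qpoch (- z) q (Suc m)) = G * inverse (qpoch (- (z * q)) q m)"
      unfolding qpoch_Suc' fps_inverse_mult G_def by simp
    have e1: "2 * (Suc m choose 2) = m + m * m"
      using square_eq_choose_two[of m] by (simp add: Suc_choose_two)
    have e2: "Suc m * Suc m = (m + m * m) + Suc m" by simp
    have "A (Suc m) = K * I"
      unfolding A_def K_def fps_inverse_mult J e1 I_def[symmetric] by (simp only: mult_ac)
    moreover have "L (Suc m) = K * I * (q * q ^ m)"
      unfolding L_def K_def fps_inverse_mult J e2 I_def[symmetric] power_add[of q _ "Suc m"]
        power_Suc[of q m] by (simp only: mult_ac)
    moreover have "a * z * G * f m = - (K * (I * (1 - q * q ^ m)))"
      unfolding f_def K_def fps_inverse_mult I power_mult_distrib[of "- a"] power_mult_distrib[of z q]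
        power_Suc[of "- a * z"] power_add[of q m] by (simp add: mult_ac power_mult_distrib)
    ultimately show ?thesis by (simp add: algebra_simps)
  qed
  have "(\<lambda>n. \<Sum>m<Suc n. A m) \<longlonglongrightarrow> SL - a * z * G * S"
  proof -
    have "(\<Sum>m<Suc n. A m) = (\<Sum>m<Suc n. L m) - a * z * G * (\<Sum>m<n. f m)" for n
      unfolding sum.lessThan_Suc_shift by (simp add: AL AL0 sum_subtractf sum_distrib_left)
    moreover have "(\<lambda>n. (\<Sum>m<Suc n. L m) - a * z * G * (\<Sum>m<n. f m)) \<longlonglongrightarrow> SL - a * z * G * S"
      using SL S unfolding sums_def L_def[symmetric]
      by (intro tendsto_diff_fps tendsto_mult_fps tendsto_const LIMSEQ_Suc)
    ultimately show ?thesis by simp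
  qed
  moreover have "(\<lambda>n. \<Sum>m<Suc n. A m) \<longlonglongrightarrow> SA"
    using SA unfolding sums_def A_def[symmetric] by (rule LIMSEQ_Suc)
  ultimately have SA_eq: "SA = SL - a * z * G * S"
    by (rule LIMSEQ_unique[rotated])
  \<comment> \<open>Both limits are multiples of \<open>Q\<close>; the factor \<open>1 + z\<close>
    by which they differ cancels against \<open>G\<close>.\<close>
  define Q where "Q = qpoch_inf (- (z * q)) q"
  have Qz: "qpoch_inf (- z) q = (1 + z) * Q"
    using qpoch_inf_split[OF q, of "- z" 1] by (simp add: Q_def qpoch_def)
  have "(\<lambda>n. (1 + x) * word_sum (1 - a) (\<lambda>j. if j = 0 then x * z else z * q ^ j) (\<lambda>_. 1) (Suc n))
    \<longlonglongrightarrow> (1 + x) * ((1 + z) * Q * SL - (1 - x) * z * (Q * S))"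
    unfolding word_sum_first
    using word_sum_geometric_LIMSEQ[OF q z SL] word_sum_geometric_LIMSEQ[OF q zq S[unfolded f_def]]
    unfolding Qz Q_def[symmetric]
    by (intro tendsto_diff_fps tendsto_mult_fps tendsto_const LIMSEQ_Suc)
  also have "(1 + x) * ((1 + z) * Q * SL - (1 - x) * z * (Q * S))
      = (1 + z) * Q * SL + x * ((1 + z) * Q * SL) - a * z * (Q * S)"
    unfolding a by (simp add: algebra_simps)
  also have "\<dots> = (1 + z) * Q * (SA + x * SL)"
  proof -
    have "a * z * (Q * S) = ((1 + z) * G) * (a * z * (Q * S))" by (simp add: G)
    also have "\<dots> = (1 + z) * Q * (a * z * G * S)" by (simp only: mult_ac)
    finally show ?thesis unfolding SA_eq by (simp only: algebra_simps)
  qed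
  finally show ?thesis unfolding Qz .
qed

text \<open>The case \<open>z = q\<close>: the two denominators pair up to
  \<open>qpoch (q ^ 2) (q ^ 2) m\<close>, so both series are Euler expansions with base
  \<open>q ^ 2\<close>.\<close>

lemma word_sum_integers_LIMSEQ:
  fixes q x a :: "'a::field_char_0 fps"
  assumes q: "q $ 0 = 0" and a: "a = (1 - x) * (1 + x)"
  shows "(\<lambda>n. (1 + x) * word_sum (1 - a) (\<lambda>j. if j = 0 then x * q else q * q ^ j) (\<lambda>_. 1) (Suc n))
    \<longlonglongrightarrow> qpoch_inf (- q) q * (qpoch_inf (a * q) (q ^ 2) + x * qpoch_inf (a * q ^ 2) (q ^ 2))"
proof (rule word_sum_first_LIMSEQ[OF q q a])
  have den: "qpoch q q m * qpoch (- q) q m = qpoch (q ^ 2) (q ^ 2) m" for m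
  proof (induction m)
    case (Suc m)
    have "qpoch q q (Suc m) * qpoch (- q) q (Suc m)
        = (qpoch q q m * qpoch (- q) q m) * ((1 - q * q ^ m) * (1 - - q * q ^ m))"
      unfolding qpoch_Suc by (simp only: mult_ac)
    also have "(1 - q * q ^ m) * (1 - - q * q ^ m) = 1 - q ^ 2 * (q ^ 2) ^ m"
      by (simp add: algebra_simps power2_eq_square power_mult_distrib)
    finally show ?case unfolding Suc by (simp add: qpoch_Suc)
  qed simp
  have q2: "(q ^ 2) $ 0 = 0" using q by simp
  show "(\<lambda>m. (- a * q) ^ m * q ^ (2 * (m choose 2)) * inverse (qpoch q q m * qpoch (- q) q m))
      sums qpoch_inf (a * q) (q ^ 2)"
    using euler_sums[OF q2, of "- a * q"] unfolding den power_mult[symmetric] by simp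
  have "(- a * q) ^ m * q ^ (m * m) = (- a * q ^ 2) ^ m * (q ^ 2) ^ (m choose 2)" for m
    unfolding square_eq_choose_two power_add power_mult power_mult_distrib
    by (simp add: power2_eq_square power_mult_distrib mult_ac)
  then show "(\<lambda>m. (- a * q) ^ m * q ^ (m * m) * inverse (qpoch q q m * qpoch (- q) q m))
      sums qpoch_inf (a * q ^ 2) (q ^ 2)"
    using euler_sums[OF q2, of "- a * q ^ 2"] unfolding den by simp
qed

text \<open>Keeping only the even terms of Euler's expansion produces the two conjugate products in the
  series \<open>H_star\<close>.\<close>

lemma sums_even_terms_fps:
  fixes f :: "nat \<Rightarrow> 'a::comm_ring_1 fps"
  assumes "f sums s" "(\<lambda>n. (- 1) ^ n * f n) sums s'"
  shows "(\<lambda>m. 2 * f (2 * m)) sums (s + s')"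
proof -
  have split: "(\<Sum>m<n. 2 * f (2 * m)) = (\<Sum>k<2 * n. f k) + (\<Sum>k<2 * n. (- 1) ^ k * f k)" for n
    by (induction n) (simp_all add: algebra_simps)
  have even: "(\<lambda>n. \<Sum>k<2 * n. g k) \<longlonglongrightarrow> l" if "g sums l" for g and l :: "'a fps"
    using LIMSEQ_subseq_LIMSEQ[OF that[unfolded sums_def], of "(*) 2"]
    by (simp add: strict_mono_def o_def)
  show ?thesis
    unfolding sums_def split by (intro tendsto_add_fps even assms)
qed

text \<open>The case \<open>z = p\<close>, \<open>q = p ^ 2\<close>: the denominators interleave to
  \<open>qpoch (- p) (- p) (2 * m)\<close>, the even-indexed denominators of an Euler expansion with
  base \<open>- p\<close>. Its argument occurs to the power \<open>2 * m\<close>, so it has to be a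
  square root \<open>c\<close> of \<open>a\<close>.\<close>

lemma word_sum_half_integers_LIMSEQ:
  fixes p x c :: "'a::field_char_0 fps"
  assumes p: "p $ 0 = 0" and c: "c ^ 2 = (1 - x) * (1 + x)"
  shows "(\<lambda>n. 2 * ((1 + x) * word_sum (1 - c ^ 2) (\<lambda>j. if j = 0 then x * p else p * (p ^ 2) ^ j) (\<lambda>_. 1) (Suc n)))
    \<longlonglongrightarrow> qpoch_inf (- p) (p ^ 2) *
      ((1 + c + x) * qpoch_inf (c * p) (- p) + (1 - c + x) * qpoch_inf (- (c * p)) (- p))"
proof -
  have p': "(p ^ 2) $ 0 = 0" "(- p) $ 0 = 0" using p by simp_all
  have den: "qpoch (p ^ 2) (p ^ 2) m * qpoch (- p) (p ^ 2) m = qpoch (- p) (- p) (2 * m)" for m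
  proof (induction m)
    case (Suc m)
    have "qpoch (p ^ 2) (p ^ 2) (Suc m) * qpoch (- p) (p ^ 2) (Suc m)
        = (qpoch (p ^ 2) (p ^ 2) m * qpoch (- p) (p ^ 2) m)
          * ((1 - p ^ 2 * (p ^ 2) ^ m) * (1 - - p * (p ^ 2) ^ m))"
      unfolding qpoch_Suc by (simp only: mult_ac)
    also have "\<dots> = qpoch (- p) (- p) (Suc (Suc (2 * m)))"
    proof -
      have "(- p) ^ (2 * m) = (p ^ 2) ^ m"
        by (simp add: power_mult)
      then show ?thesis
        unfolding Suc qpoch_Suc power_Suc by (simp add: power2_eq_square mult_ac)
    qed
    finally show ?case by simp
  qed simp
  define E where "E c m = c ^ m * (- p) ^ (m choose 2) * inverse (qpoch (- p) (- p) m)" for c m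
  have E: "(\<lambda>m. 2 * E c (2 * m)) sums (qpoch_inf (- c) (- p) + qpoch_inf c (- p))" for c
  proof (rule sums_even_terms_fps)
    show "E c sums qpoch_inf (- c) (- p)"
      unfolding E_def by (rule euler_sums) (use p in simp)
    have "(\<lambda>m. E (- c) m) sums qpoch_inf c (- p)"
      unfolding E_def using euler_sums[OF p'(2), of "- c"] by simp
    also have "(\<lambda>m. E (- c) m) = (\<lambda>m. (- 1) ^ m * E c m)"
      unfolding E_def by (subst power_minus) (simp only: mult.assoc)
    finally show "(\<lambda>m. (- 1) ^ m * E c m) sums qpoch_inf c (- p)" .
  qed
  \<comment> \<open>The summand \<open>m\<close> fixes the parity: the base \<open>- p\<close>
    produces the sign \<open>(- 1) ^ m\<close> required by \<open>- (c ^ 2)\<close>.\<close>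
  have ch: "2 * m choose 2 = 2 * (2 * (m choose 2)) + m" for m
    using square_eq_choose_two[of m] by (simp add: mult_2 choose_two_add)
  have sgn: "(- p) ^ (2 * m choose 2) = (- 1) ^ m * p ^ m * (p ^ 2) ^ (2 * (m choose 2))" for m
    unfolding ch power_add by (subst (2) power_minus) (simp add: power_mult mult_ac)
  define B where "B m = inverse (qpoch (p ^ 2) (p ^ 2) m * qpoch (- p) (p ^ 2) m)" for m
  have A_eq: "(- (c ^ 2) * p) ^ m * (p ^ 2) ^ (2 * (m choose 2)) * B m = E c (2 * m)" for m
  proof -
    have "(- (c ^ 2) * p) ^ m = (- 1) ^ m * c ^ (2 * m) * p ^ m"
      by (subst power_mult_distrib, subst power_minus) (simp add: power_mult)
    then show ?thesis unfolding E_def B_def den sgn by (simp only: mult_ac)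
  qed
  \<comment> \<open>The additional exponent contributes \<open>(p ^ 2) ^ m = p ^ (2 * m)\<close>,
    which is absorbed by replacing the argument \<open>c\<close> by \<open>c * p\<close>.\<close>
  have L_eq: "(- (c ^ 2) * p) ^ m * (p ^ 2) ^ (m * m) * B m = E (c * p) (2 * m)" for m
  proof -
    have "(- (c ^ 2) * p) ^ m * (p ^ 2) ^ (m * m)
        = ((- (c ^ 2) * p) ^ m * (p ^ 2) ^ (2 * (m choose 2))) * p ^ (2 * m)"
      unfolding square_eq_choose_two power_add power_mult by (simp only: mult_ac)
    then have "(- (c ^ 2) * p) ^ m * (p ^ 2) ^ (m * m) * B m = E c (2 * m) * p ^ (2 * m)"
      unfolding A_eq[symmetric] by (simp only: mult_ac)
    also have "\<dots> = E (c * p) (2 * m)"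
      unfolding E_def power_mult_distrib by (simp only: mult_ac)
    finally show ?thesis .
  qed
  define h :: "'a fps" where "h = fps_const (1 / 2)"
  have h: "h * 2 = 1"
    unfolding h_def numeral_fps_const fps_const_mult by simp
  have Eh: "(\<lambda>m. E c (2 * m)) sums (h * (qpoch_inf (- c) (- p) + qpoch_inf c (- p)))" for c
    using sums_mult_fps[OF E, of h c] by (simp add: h flip: mult.assoc)
  \<comment> \<open>Splitting off one factor multiplies the argument by \<open>- p\<close>, so the
    products with arguments \<open>- c\<close> and \<open>c\<close> reduce to those with
    \<open>c * p\<close> and \<open>- (c * p)\<close>. Two products remain instead of four.\<close>
  define U V where "U = qpoch_inf (c * p) (- p)" and "V = qpoch_inf (- (c * p)) (- p)"
  have U: "qpoch_inf (- c) (- p) = (1 + c) * U"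
    using qpoch_inf_split[OF p'(2), of "- c" 1] by (simp add: U_def qpoch_def)
  have V: "qpoch_inf c (- p) = (1 - c) * V"
    using qpoch_inf_split[OF p'(2), of c 1] by (simp add: V_def qpoch_def)
  have "(\<lambda>n. 2 * ((1 + x) * word_sum (1 - c ^ 2) (\<lambda>j. if j = 0 then x * p else p * (p ^ 2) ^ j)
        (\<lambda>_. 1) (Suc n)))
    \<longlonglongrightarrow> 2 * (qpoch_inf (- p) (p ^ 2) * (h * (qpoch_inf (- c) (- p) + qpoch_inf c (- p))
      + x * (h * (qpoch_inf (- (c * p)) (- p) + qpoch_inf (c * p) (- p)))))"
    using Eh[of c] Eh[of "c * p"]
    by (intro tendsto_mult_fps tendsto_const word_sum_first_LIMSEQ p p' c)
       (simp_all only: B_def[symmetric] A_eq L_eq)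
  also have "2 * (qpoch_inf (- p) (p ^ 2) * (h * (qpoch_inf (- c) (- p) + qpoch_inf c (- p))
      + x * (h * (qpoch_inf (- (c * p)) (- p) + qpoch_inf (c * p) (- p)))))
    = h * 2 * (qpoch_inf (- p) (p ^ 2) * ((1 + c + x) * U + (1 - c + x) * V))"
    unfolding U V U_def[symmetric] V_def[symmetric] by (simp add: algebra_simps)
  finally show ?thesis
    unfolding h U_def V_def by simp
qed

section \<open>Splitting by residues\<close>

text \<open>The classes of integers modulo \<open>t\<close> up to sign, represented by \<open>0, \<dots>, t div 2\<close>: the
  antisymmetry of \<open>maya S\<close> couples the residues \<open>r\<close> and \<open>t - r\<close>.\<close>

definition residue_class :: "nat \<Rightarrow> int \<Rightarrow> nat" where
  "residue_class t a = nat (min (a mod int t) ((- a) mod int t))"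

lemma residue_class_uminus: "residue_class t (- a) = residue_class t a"
  by (simp add: residue_class_def min.commute)

lemma residue_class_eq_0_iff:
  assumes "t > 0"
  shows "residue_class t a = 0 \<longleftrightarrow> a mod int t = 0"
proof -
  have "0 \<le> a mod int t" "a mod int t < int t"
    using assms by auto
  then show ?thesis
    by (auto simp: residue_class_def zmod_zminus1_eq_if min_def)
qed

lemma residue_class_eq_iff:
  assumes "0 < r" "2 * r \<le> t"
  shows "residue_class t a = r \<longleftrightarrow> a mod int t = int r \<or> a mod int t = int (t - r)"
proof -
  have "0 \<le> a mod int t" "a mod int t < int t"
    using assms by auto
  then show ?thesis
    using assms by (auto simp: residue_class_def zmod_zminus1_eq_if min_def of_nat_diff)
qed

lemma residue_class_le:
  assumes "t > 0"
  shows "residue_class t a \<le> t div 2"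
proof -
  have "2 * residue_class t a \<le> t"
  proof (cases "a mod int t = 0")
    case False
    moreover have "a mod int t < int t" "0 \<le> a mod int t"
      using assms by auto
    ultimately show ?thesis
      by (auto simp: residue_class_def zmod_zminus1_eq_if min_def)
  qed (simp add: residue_class_def)
  then show ?thesis by simp
qed

lemma int_mem_maya: "n > 0 \<Longrightarrow> int n \<in> maya S \<longleftrightarrow> n \<in> S"
  and minus_int_mem_maya: "n > 0 \<Longrightarrow> - int n \<in> maya S \<longleftrightarrow> n \<notin> S"
  by (simp_all add: maya_def)

definition class_hooks :: "nat \<Rightarrow> nat \<Rightarrow> nat set \<Rightarrow> nat" where
  "class_hooks t r S = card {a. a \<in> maya S \<and> a - int t \<notin> maya S \<and> residue_class t a = r}"

lemma finite_hook_beads: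
  assumes "finite S"
  shows "finite {a \<in> maya S. a - int t \<notin> maya S}"
proof (rule finite_subset)
  let ?m = "int (Max (insert 0 S))"
  show "{a \<in> maya S. a - int t \<notin> maya S} \<subseteq> {- ?m..?m + int t}"
  proof
    fix a assume a: "a \<in> {a \<in> maya S. a - int t \<notin> maya S}"
    have "int n \<le> ?m" if "n \<in> S" for n
      using assms that by auto
    from this[of "nat a"] this[of "nat (- (a - int t))"] show "a \<in> {- ?m..?m + int t}"
      using a by (cases "a \<ge> 0"; cases "a - int t \<ge> 0") (auto simp: maya_def)
  qed
qed simp

text \<open>A hook compares \<open>a\<close> with \<open>a - t\<close>, which lie in one class, and
  whether \<open>a\<close> is a bead depends only on the absolute value of \<open>a\<close>, again
  in that class. So hooks of a class see only the parts of that class.\<close>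

lemma hook_count_eq_sum:
  assumes "finite S" "t > 0"
  shows "hook_count t S = (\<Sum>r\<le>t div 2. class_hooks t r {n \<in> S. residue_class t (int n) = r})"
proof -
  let ?H = "{a \<in> maya S. a - int t \<notin> maya S}"
  have "hook_count t S = (\<Sum>r\<le>t div 2. \<Sum>a\<in>{a \<in> ?H. residue_class t a = r}. 1)"
    unfolding hook_count_def card_eq_sum
    by (rule sum.group[symmetric]) (use assms residue_class_le in \<open>auto intro: finite_hook_beads\<close>)
  also have "\<dots> = (\<Sum>r\<le>t div 2. class_hooks t r {n \<in> S. residue_class t (int n) = r})"
  proof (rule sum.cong)
    fix r
    have maya_cut: "a \<in> maya {n \<in> S. residue_class t (int n) = r} \<longleftrightarrow> a \<in> maya S"
      if "residue_class t a = r" for a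
      using that residue_class_uminus[of t a] by (auto simp: maya_def)
    have shift: "residue_class t (a - int t) = residue_class t a" for a
      by (simp add: residue_class_def mod_diff_eq)
    have "{a \<in> ?H. residue_class t a = r} =
        {a. a \<in> maya {n \<in> S. residue_class t (int n) = r} \<and>
          a - int t \<notin> maya {n \<in> S. residue_class t (int n) = r} \<and> residue_class t a = r}"
      using maya_cut shift by auto
    then show "(\<Sum>a\<in>{a \<in> ?H. residue_class t a = r}. 1) =
        class_hooks t r {n \<in> S. residue_class t (int n) = r}"
      by (simp add: class_hooks_def)
  qed auto
  finally show ?thesis .
qed

text \<open>Distributivity: a subset of \<open>B\<close> is an independent choice of a subset of
  each fibre of \<open>c\<close>.\<close>

lemma sum_Pow_partition:
  fixes f :: "'i \<Rightarrow> 'b set \<Rightarrow> 'a::comm_semiring_1"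
  assumes "finite I" "finite B" "c ` B \<subseteq> I"
  shows "(\<Sum>S\<in>Pow B. \<Prod>i\<in>I. f i {n \<in> S. c n = i}) = (\<Prod>i\<in>I. \<Sum>T\<in>Pow {n \<in> B. c n = i}. f i T)"
proof -
  have "(\<Prod>i\<in>I. \<Sum>T\<in>Pow {n \<in> B. c n = i}. f i T)
      = (\<Sum>g\<in>PiE I (\<lambda>i. Pow {n \<in> B. c n = i}). \<Prod>i\<in>I. f i (g i))"
    using assms by (intro prod_sum_PiE) auto
  also have "\<dots> = (\<Sum>S\<in>Pow B. \<Prod>i\<in>I. f i {n \<in> S. c n = i})"
  proof (rule sum.reindex_bij_witness[where i = "\<lambda>S. \<lambda>i\<in>I. {n \<in> S. c n = i}" and j = "\<lambda>g. \<Union>i\<in>I. g i"])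
    fix g assume g: "g \<in> PiE I (\<lambda>i. Pow {n \<in> B. c n = i})"
    have cut: "{n \<in> \<Union>i\<in>I. g i. c n = i} = g i" if "i \<in> I" for i
      using that g by (auto simp: PiE_iff Pow_def)
    show "(\<lambda>i\<in>I. {n \<in> \<Union>i\<in>I. g i. c n = i}) = g"
      using g cut by (auto simp: fun_eq_iff restrict_def PiE_iff extensional_def)
    show "(\<Prod>i\<in>I. f i {n \<in> \<Union>i\<in>I. g i. c n = i}) = (\<Prod>i\<in>I. f i (g i))"
      using cut by (intro prod.cong) auto
    show "(\<Union>i\<in>I. g i) \<in> Pow B"
      using g by (fastforce simp: PiE_iff)
  next
    fix S assume "S \<in> Pow B"
    with assms(3) show "(\<Union>i\<in>I. (\<lambda>i\<in>I. {n \<in> S. c n = i}) i) = S"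
      by auto
    show "(\<lambda>i\<in>I. {n \<in> S. c n = i}) \<in> PiE I (\<lambda>i. Pow {n \<in> B. c n = i})"
      using \<open>S \<in> Pow B\<close> by auto
  qed
  finally show ?thesis ..
qed

text \<open>The cut-off \<open>t * M\<close> gives each class a complete word: for
  \<open>M > 0\<close> there are \<open>M - 1\<close> positions for the class of 0, \<open>M\<close>
  for that of \<open>t / 2\<close> and \<open>2 * M\<close> for a pair \<open>r\<close>,
  \<open>t - r\<close>.\<close>

definition class_sum :: "nat \<Rightarrow> 'a::field_char_0 \<Rightarrow> nat \<Rightarrow> nat \<Rightarrow> 'a fps" where
  "class_sum t x M r =
     (\<Sum>T\<in>Pow {n \<in> {0<..<t * M}. residue_class t (int n) = r}.
        fps_const x ^ class_hooks t r T * fps_X ^ (2 * \<Sum>T))"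

lemma F_series_LIMSEQ:
  fixes x :: "'a::field_char_0"
  assumes t: "t > 0"
  shows "(\<lambda>M. \<Prod>r\<le>t div 2. class_sum t x M r) \<longlonglongrightarrow> F_series t x"
proof (rule tendsto_fpsI)
  fix n
  have fact: "(\<Prod>r\<le>t div 2. class_sum t x M r) =
      (\<Sum>S\<in>Pow {0<..<t * M}. fps_const x ^ hook_count t S * fps_X ^ (2 * \<Sum>S))" for M
  proof -
    have "(\<Prod>r\<le>t div 2. class_sum t x M r) =
        (\<Sum>S\<in>Pow {0<..<t * M}. \<Prod>r\<le>t div 2. fps_const x ^ class_hooks t r {n \<in> S. residue_class t (int n) = r}
          * fps_X ^ (2 * \<Sum>{n \<in> S. residue_class t (int n) = r}))"
      unfolding class_sum_def
      by (rule sum_Pow_partition[symmetric]) (use t residue_class_le in auto)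
    also have "\<dots> = (\<Sum>S\<in>Pow {0<..<t * M}. fps_const x ^ hook_count t S * fps_X ^ (2 * \<Sum>S))"
    proof (rule sum.cong)
      fix S assume "S \<in> Pow {0<..<t * M}"
      then have fin: "finite S" by (auto intro: finite_subset)
      have "\<Sum>S = (\<Sum>r\<le>t div 2. \<Sum>{n \<in> S. residue_class t (int n) = r})"
        by (rule sum.group[symmetric]) (use fin t residue_class_le in auto)
      then show "(\<Prod>r\<le>t div 2. fps_const x ^ class_hooks t r {n \<in> S. residue_class t (int n) = r}
          * fps_X ^ (2 * \<Sum>{n \<in> S. residue_class t (int n) = r}))
          = fps_const x ^ hook_count t S * fps_X ^ (2 * \<Sum>S)"
        unfolding hook_count_eq_sum[OF fin t]
        by (simp add: prod.distrib power_sum sum_distrib_left)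
    qed auto
    finally show ?thesis .
  qed
  \<comment> \<open>Once \<open>M > n\<close>, the cut-off excludes no set of parts that contributes
    to coefficient \<open>n\<close>.\<close>
  show "eventually (\<lambda>M. fps_nth (\<Prod>r\<le>t div 2. class_sum t x M r) n = fps_nth (F_series t x) n) sequentially"
    using eventually_gt_at_top[of n]
  proof eventually_elim
    case (elim M)
    have sets: "{S \<in> Pow {0<..<t * M}. 2 * \<Sum>S = n} = {S. finite S \<and> 0 \<notin> S \<and> 2 * \<Sum>S = n}"
    proof (intro equalityI subsetI)
      fix S assume "S \<in> {S. finite S \<and> 0 \<notin> S \<and> 2 * \<Sum>S = n}"
      then have S: "finite S" "0 \<notin> S" "2 * \<Sum>S = n" by auto
      have "k < t * M" if "k \<in> S" for k
      proof -
        have "k \<le> \<Sum>S" using S that by (intro member_le_sum) auto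
        also have "\<dots> < M" using S elim by simp
        also have "\<dots> \<le> t * M" using t by simp
        finally show ?thesis .
      qed
      with S show "S \<in> {S \<in> Pow {0<..<t * M}. 2 * \<Sum>S = n}"
        by (auto intro: gr0I)
    qed (auto intro: finite_subset)
    have "fps_nth (fps_const x ^ hook_count t S * fps_X ^ (2 * \<Sum>S)) n
        = (if 2 * \<Sum>S = n then x ^ hook_count t S else 0)" for S
      by (simp add: fps_const_power fps_X_power_nth)
    then have "fps_nth (\<Prod>r\<le>t div 2. class_sum t x M r) n =
        (\<Sum>S\<in>Pow {0<..<t * M}. if 2 * \<Sum>S = n then x ^ hook_count t S else 0)"
      by (simp only: fact fps_sum_nth)
    also have "\<dots> = (\<Sum>S\<in>{S \<in> Pow {0<..<t * M}. 2 * \<Sum>S = n}. x ^ hook_count t S)"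
      by (intro sum.inter_filter[symmetric]) simp
    finally show ?case
      unfolding sets F_series_nth[OF t] .
  qed
qed

section \<open>Residue classes as binary words\<close>

lemma power_sum_eq_prod:
  fixes X :: "'a::comm_semiring_1"
  assumes "finite C" "T \<subseteq> C"
  shows "X ^ (2 * \<Sum>T) = (\<Prod>n\<in>C. if n \<in> T then X ^ (2 * n) else 1)"
proof -
  have "(\<Prod>n\<in>C. if n \<in> T then X ^ (2 * n) else 1) = (\<Prod>n\<in>C \<inter> T. X ^ (2 * n))"
    using assms(1) by (simp add: prod.inter_restrict)
  also have "C \<inter> T = T" using assms(2) by auto
  finally show ?thesis by (simp add: power_sum sum_distrib_left)
qed

text \<open>An ascent from \<open>j\<close> to \<open>j + 1\<close> yields a hook at the bead
  \<open>t * (j + 1) + d\<close> and a mirror hook at \<open>- (t * j + d)\<close>. An occupied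
  position 0 yields only the hook at \<open>d\<close>: the partner \<open>d - t\<close> is 0, always
  a gap, or \<open>- d\<close>, a gap because \<open>d\<close> is a bead.\<close>

lemma class_hooks_one_sided:
  assumes t: "t > 0" and d: "d = t \<or> 2 * d = t"
    and cls: "\<And>n. n > 0 \<Longrightarrow> residue_class t (int n) = r \<longleftrightarrow> (\<exists>j. n = t * j + d)"
    and W: "finite W"
  shows "class_hooks t r ((\<lambda>j. t * j + d) ` W) = 2 * ascents W + (if 0 \<in> W then 1 else 0)"
proof -
  let ?f = "\<lambda>j. t * j + d"
  define T where "T = ?f ` W"
  define A where "A = {j. j \<notin> W \<and> Suc j \<in> W}"
  have d0: "d > 0" using t d by auto
  have inj: "?f j = ?f k \<longleftrightarrow> j = k" for j k using t by auto
  have f0: "?f j > 0" for j using d0 by simp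
  have mem: "?f j \<in> T \<longleftrightarrow> j \<in> W" for j
    using inj by (auto simp: T_def)
  have pos: "int (?f j) \<in> maya T \<longleftrightarrow> j \<in> W" for j
    unfolding int_mem_maya[OF f0] by (rule mem)
  have neg: "- int (?f j) \<in> maya T \<longleftrightarrow> j \<notin> W" for j
    unfolding minus_int_mem_maya[OF f0] mem ..
  have zero: "0 \<notin> maya T" by (simp add: maya_def)
  have finA: "finite A"
    unfolding A_def by (rule finite_subset[of _ "(\<lambda>j. j - 1) ` W"]) (use W in \<open>force simp: image_iff\<close>)+
  let ?H = "{a. a \<in> maya T \<and> a - int t \<notin> maya T \<and> residue_class t a = r}"
  have "?H = (\<lambda>j. int (?f (Suc j))) ` A \<union> ((\<lambda>j. - int (?f j)) ` A \<union> (if 0 \<in> W then {int d} else {}))"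
    (is "_ = ?R")
  proof (intro equalityI subsetI)
    fix a assume a: "a \<in> ?H"
    then have aH: "a \<in> maya T" "a - int t \<notin> maya T" by simp_all
    then have "a \<noteq> 0" using zero by auto
    then consider "a > 0" | "a < 0" by linarith
    then show "a \<in> ?R"
    proof cases
      case 1
      then obtain j where "nat a = ?f j"
        using a cls[of "nat a"] by auto
      have j: "a = int (?f j)"
        by (subst \<open>nat a = ?f j\<close>[symmetric]) (use 1 in simp)
      show ?thesis
      proof (cases j)
        case 0
        then have "a = int d" using j by simp
        moreover have "0 \<in> W" using aH(1) pos[of j] 0 unfolding j by simp
        ultimately show ?thesis by simp
      next
        case (Suc k)
        have e: "a - int t = int (?f k)" using j Suc by simp
        have "k \<notin> W" using aH(2) unfolding e pos by simp
        moreover have "Suc k \<in> W" using aH(1) Suc unfolding j pos by simp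
        ultimately have "k \<in> A" by (simp add: A_def)
        then show ?thesis using j Suc by blast
      qed
    next
      case 2
      then obtain j where "nat (- a) = ?f j"
        using a cls[of "nat (- a)"] by (auto simp: residue_class_uminus)
      have j: "a = - int (?f j)"
        by (subst \<open>nat (- a) = ?f j\<close>[symmetric]) (use 2 in simp)
      have e: "a - int t = - int (?f (Suc j))" using j by simp
      have "Suc j \<in> W" using aH(2) unfolding e neg by simp
      moreover have "j \<notin> W" using aH(1) unfolding j neg by simp
      ultimately have "j \<in> A" by (simp add: A_def)
      then show ?thesis using j by blast
    qed
  next
    fix a assume a: "a \<in> ?R"
    have c1: "residue_class t (int (?f j)) = r" for j
      using cls[of "?f j"] d0 by blast
    have c2: "residue_class t (- int (?f j)) = r" for j
      using c1[of j] by (simp only: residue_class_uminus)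
    from a consider j where "j \<in> A" "a = int (?f (Suc j))" | j where "j \<in> A" "a = - int (?f j)"
      | "0 \<in> W" "a = int d"
      by (auto split: if_splits)
    then show "a \<in> ?H"
    proof cases
      case 1
      have "a - int t = int (?f j)" using 1 by simp
      then show ?thesis using 1 c1[of "Suc j"] pos[of "Suc j"] pos[of j] unfolding A_def by simp
    next
      case 2
      have e: "a - int t = - int (?f (Suc j))" using 2 by simp
      have "a \<in> maya T" unfolding 2(2) neg using 2(1) by (simp add: A_def)
      moreover have "a - int t \<notin> maya T" unfolding e neg using 2(1) by (simp add: A_def)
      moreover have "residue_class t a = r" unfolding 2(2) by (rule c2)
      ultimately show ?thesis by simp
    next
      case 3
      from d have "a - int t \<notin> maya T"
      proof
        assume "d = t"
        with 3 zero show ?thesis by simp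
      next
        assume "2 * d = t"
        with 3 have e: "a - int t = - int (?f 0)" by simp
        show ?thesis unfolding e neg using 3 by simp
      qed
      then show ?thesis using 3 c1[of 0] pos[of 0] by simp
    qed
  qed
  moreover have "card ?R = card A + (card A + (if 0 \<in> W then 1 else 0))"
  proof -
    have "int d \<notin> (\<lambda>j. - int (?f j)) ` A"
    proof
      assume "int d \<in> (\<lambda>j. - int (?f j)) ` A"
      then obtain j where "int d = - int (?f j)" by blast
      with d0 of_nat_0_le_iff[of "?f j", where 'a = int] show False by linarith
    qed
    moreover have "card ((\<lambda>j. - int (?f j)) ` A) = card A"
      using t by (intro card_image) (auto simp: inj_on_def)
    ultimately have "card ((\<lambda>j. - int (?f j)) ` A \<union> (if 0 \<in> W then {int d} else {})) = card A + (if 0 \<in> W then 1 else 0)"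
      using finA by simp
    moreover have "card ((\<lambda>j. int (?f (Suc j))) ` A) = card A"
      using t by (intro card_image) (auto simp: inj_on_def)
    moreover have "(\<lambda>j. int (?f (Suc j))) ` A \<inter> ((\<lambda>j. - int (?f j)) ` A \<union> (if 0 \<in> W then {int d} else {})) = {}"
    proof -
      have "int (?f (Suc j)) \<noteq> - int (?f k)" "int (?f (Suc j)) \<noteq> int d" for j k
        using t d0 by (auto simp del: of_nat_add of_nat_mult)
      then show ?thesis by (auto split: if_splits)
    qed
    ultimately show ?thesis
      using finA by (subst card_Un_disjoint) auto
  qed
  ultimately show ?thesis
    by (simp add: class_hooks_def ascents_def T_def[symmetric] A_def)
qed

lemma class_sum_one_sided:
  fixes x :: "'a::field_char_0"
  assumes t: "t > 0" and d: "d = t \<or> 2 * d = t"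
    and cls: "\<And>n. n > 0 \<Longrightarrow> residue_class t (int n) = r \<longleftrightarrow> (\<exists>j. n = t * j + d)"
    and n: "\<And>j. t * j + d < t * M \<longleftrightarrow> j < n"
  shows "class_sum t x M r = word_sum (fps_const x ^ 2)
     (\<lambda>j. if j = 0 then fps_const x * fps_X ^ (2 * d) else fps_X ^ (2 * d) * (fps_X ^ (2 * t)) ^ j) (\<lambda>_. 1) n"
proof -
  let ?f = "\<lambda>j. t * j + d" and ?x = "fps_const x"
  have d0: "d > 0" using t d by auto
  have C: "{n \<in> {0<..<t * M}. residue_class t (int n) = r} = ?f ` {..<n}" (is "?C = _")
  proof (intro equalityI subsetI)
    fix k assume "k \<in> ?C"
    then show "k \<in> ?f ` {..<n}"
      using cls[of k] n by auto
  next
    fix k assume "k \<in> ?f ` {..<n}"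
    then obtain j where "k = ?f j" "j < n" by auto
    then show "k \<in> ?C"
      using cls[of k] n[of j] d0 by auto
  qed
  have inj: "inj_on ?f A" for A using t by (auto simp: inj_on_def)
  have term_eq: "?x ^ class_hooks t r (?f ` W) * fps_X ^ (2 * \<Sum>(?f ` W))
      = (?x ^ 2) ^ ascents W * (\<Prod>j<n. if j \<in> W then
          (if j = 0 then ?x * fps_X ^ (2 * d) else fps_X ^ (2 * d) * (fps_X ^ (2 * t)) ^ j) else 1)"
    if W: "W \<subseteq> {..<n}" for W
  proof -
    have "finite W" using W by (rule finite_subset) simp
    have e: "fps_X ^ (2 * (t * j + d)) = (fps_X ^ (2 * d) * (fps_X ^ (2 * t)) ^ j :: 'a fps)" for j
    proof -
      have "2 * (t * j + d) = 2 * d + 2 * t * j" by simp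
      then show ?thesis by (simp only: power_add power_mult)
    qed
    have "(fps_X :: 'a fps) ^ (2 * \<Sum>(?f ` W)) = (\<Prod>k\<in>?f ` {..<n}. if k \<in> ?f ` W then fps_X ^ (2 * k) else 1)"
      using W by (intro power_sum_eq_prod) auto
    also have "\<dots> = (\<Prod>j<n. if j \<in> W then fps_X ^ (2 * d) * (fps_X ^ (2 * t)) ^ j else 1)"
      by (simp only: prod.reindex[OF inj] o_def e inj_image_mem_iff[OF inj])
    finally have X: "(fps_X :: 'a fps) ^ (2 * \<Sum>(?f ` W)) =
        (\<Prod>j<n. if j \<in> W then fps_X ^ (2 * d) * (fps_X ^ (2 * t)) ^ j else 1)" .
    have "class_hooks t r (?f ` W) = 2 * ascents W + (if 0 \<in> W then 1 else 0)"
      by (rule class_hooks_one_sided[OF t d _ \<open>finite W\<close>]) (rule cls)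
    then have "?x ^ class_hooks t r (?f ` W) * fps_X ^ (2 * \<Sum>(?f ` W))
      = (?x ^ 2) ^ ascents W * ((if 0 \<in> W then ?x else 1) *
          (\<Prod>j<n. if j \<in> W then fps_X ^ (2 * d) * (fps_X ^ (2 * t)) ^ j else 1))"
      unfolding X by (simp add: power_add power_mult del: fps_const_power)
    \<comment> \<open>Only position 0 carries the odd factor, so it can be absorbed into the weight
      of that position.\<close>
    also have "(if 0 \<in> W then ?x else 1) = (\<Prod>j<n. if j = 0 then (if 0 \<in> W then ?x else 1) else 1)"
      using W by (cases "n = 0") (auto simp: prod.delta)
    also have "\<dots> * (\<Prod>j<n. if j \<in> W then fps_X ^ (2 * d) * (fps_X ^ (2 * t)) ^ j else 1)
        = (\<Prod>j<n. if j \<in> W then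
          (if j = 0 then ?x * fps_X ^ (2 * d) else fps_X ^ (2 * d) * (fps_X ^ (2 * t)) ^ j) else 1)"
      unfolding prod.distrib[symmetric] by (rule prod.cong) auto
    finally show ?thesis .
  qed
  have "Pow (?f ` {..<n}) = image ?f ` Pow {..<n}"
    by (simp add: image_Pow_surj)
  moreover have "inj_on (image ?f) (Pow {..<n})"
    by (rule inj_on_image_Pow) (rule inj)
  ultimately have "class_sum t x M r =
      (\<Sum>W\<in>Pow {..<n}. ?x ^ class_hooks t r (?f ` W) * fps_X ^ (2 * \<Sum>(?f ` W)))"
    unfolding class_sum_def C by (simp add: sum.reindex)
  also have "\<dots> = (\<Sum>W\<in>Pow {..<n}. (?x ^ 2) ^ ascents W * (\<Prod>j<n. if j \<in> W then
          (if j = 0 then ?x * fps_X ^ (2 * d) else fps_X ^ (2 * d) * (fps_X ^ (2 * t)) ^ j) else 1))"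
    by (intro sum.cong refl term_eq) auto
  finally show ?thesis by (simp add: word_sum_def)
qed

lemma uminus_mem_maya: "a \<noteq> 0 \<Longrightarrow> - a \<in> maya S \<longleftrightarrow> a \<notin> maya S"
  by (auto simp: maya_def)

text \<open>The reflection \<open>a \<mapsto> t - a\<close> exchanges the hooks at residue
  \<open>r\<close> with those at \<open>t - r\<close>, because it turns the pair of bead
  \<open>a\<close> and gap \<open>a - t\<close> into the pair of bead \<open>t - a\<close> and gap
  \<open>- a\<close>. It thus suffices to count the hooks at residue \<open>r\<close>, and these are
  the ascents.\<close>

lemma class_hooks_two_sided:
  assumes r: "0 < r" "2 * r < t" and W: "W \<subseteq> {..<2 * M}"
    and maya: "\<And>k. int t * k + int r \<in> maya T \<longleftrightarrow> k < - int M \<or> (k \<ge> - int M \<and> nat (k + int M) \<in> W)"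
  shows "class_hooks t r T = 2 * ascents W"
proof -
  define b where "b k = int t * k + int r" for k
  define A where "A = {j. j \<notin> W \<and> Suc j \<in> W}"
  define H where "H = {a. a \<in> maya T \<and> a - int t \<notin> maya T \<and> residue_class t a = r}"
  define H1 where "H1 = {a. a \<in> maya T \<and> a - int t \<notin> maya T \<and> a mod int t = int r}"
  define H2 where "H2 = {a. a \<in> maya T \<and> a - int t \<notin> maya T \<and> a mod int t = int (t - r)}"
  have H: "H = H1 \<union> H2"
    using r residue_class_eq_iff[of r t] by (auto simp: H_def H1_def H2_def)
  have disj: "H1 \<inter> H2 = {}"
    using r by (auto simp: H1_def H2_def)
  have neg_mod: "(int t - a) mod int t = int (t - r) \<longleftrightarrow> a mod int t = int r"
    "(int t - a) mod int t = int r \<longleftrightarrow> a mod int t = int (t - r)" for a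
  proof -
    have "(int t - a) mod int t = (- a) mod int t"
      by (metis add_uminus_conv_diff mod_add_self1)
    then show "(int t - a) mod int t = int (t - r) \<longleftrightarrow> a mod int t = int r"
      "(int t - a) mod int t = int r \<longleftrightarrow> a mod int t = int (t - r)"
      using r by (auto simp: zmod_zminus1_eq_if of_nat_diff)
  qed
  have reflect: "int t - a \<in> maya T \<longleftrightarrow> a - int t \<notin> maya T"
    "int t - a - int t \<notin> maya T \<longleftrightarrow> a \<in> maya T" if "a mod int t \<noteq> 0" for a
  proof -
    have "a - int t \<noteq> 0" "a \<noteq> 0"
      using that by auto
    then show "int t - a \<in> maya T \<longleftrightarrow> a - int t \<notin> maya T"
      "int t - a - int t \<notin> maya T \<longleftrightarrow> a \<in> maya T"
      using uminus_mem_maya[of "a - int t" T] uminus_mem_maya[of a T] by simp_all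
  qed
  have "H2 = (\<lambda>a. int t - a) ` H1"
  proof (intro equalityI subsetI)
    fix a assume "a \<in> H2"
    then have "int t - a \<in> H1"
      using reflect[of a] neg_mod(2)[of a] r by (auto simp: H1_def H2_def)
    then show "a \<in> (\<lambda>a. int t - a) ` H1"
      by (intro image_eqI[of _ _ "int t - a"]) auto
  next
    fix a assume "a \<in> (\<lambda>a. int t - a) ` H1"
    then obtain a' where "a = int t - a'" "a' \<in> H1" by auto
    then show "a \<in> H2"
      using reflect[of a'] neg_mod(1)[of a'] r by (auto simp: H1_def H2_def)
  qed
  then have card2: "card H2 = card H1"
    by (simp add: card_image inj_on_def)
  have maya': "b k \<in> maya T \<longleftrightarrow> k < - int M \<or> (k \<ge> - int M \<and> nat (k + int M) \<in> W)" for k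
    unfolding b_def by (rule maya)
  have b_diff: "b k - int t = b (k - 1)" for k
    by (simp add: b_def algebra_simps)
  have b_mod: "b k mod int t = int r" for k
    using r by (simp add: b_def)
  \<comment> \<open>The bead of an ascent sits at window position \<open>j + 1\<close>, which is the
    integer \<open>j + 1 - M\<close>.\<close>
  have "H1 = (\<lambda>j. b (int j + 1 - int M)) ` A"
  proof (intro equalityI subsetI)
    fix a assume a: "a \<in> H1"
    define k where "k = a div int t"
    have "a = b k"
      using a mult_div_mod_eq[of "int t" a] by (simp add: H1_def b_def k_def)
    with a have "b k \<in> maya T" "b (k - 1) \<notin> maya T"
      using b_diff[of k] by (auto simp: H1_def)
    then have k: "k - 1 \<ge> - int M" "nat (k - 1 + int M) \<notin> W" "nat (k + int M) \<in> W"
      unfolding maya' by auto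
    moreover have "nat (k + int M) = Suc (nat (k - 1 + int M))"
      using k(1) by simp
    ultimately have "nat (k - 1 + int M) \<in> A" by (simp add: A_def)
    moreover have "a = b (int (nat (k - 1 + int M)) + 1 - int M)"
      using k(1) \<open>a = b k\<close> by simp
    ultimately show "a \<in> (\<lambda>j. b (int j + 1 - int M)) ` A" by blast
  next
    fix a assume "a \<in> (\<lambda>j. b (int j + 1 - int M)) ` A"
    then obtain j where j: "j \<in> A" "a = b (int j + 1 - int M)" by auto
    moreover have "nat (int j + 1) = Suc j" by simp
    ultimately have "a \<in> maya T" "a - int t \<notin> maya T"
      by (auto simp: b_diff maya' A_def)
    then show "a \<in> H1"
      using j b_mod by (simp add: H1_def)
  qed
  moreover have "inj_on (\<lambda>j. b (int j + 1 - int M)) A"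
    using r by (auto simp: inj_on_def b_def)
  ultimately have card1: "card H1 = card A"
    by (simp add: card_image)
  have "A \<subseteq> {..<2 * M}"
    using W by (auto simp: A_def)
  then have "finite A" by (rule finite_subset) simp
  have "finite H1"
    using \<open>finite A\<close> \<open>H1 = (\<lambda>j. b (int j + 1 - int M)) ` A\<close> by simp
  moreover have "finite H2"
    using \<open>finite H1\<close> \<open>H2 = (\<lambda>a. int t - a) ` H1\<close> by simp
  ultimately have "card H = 2 * card A"
    using disj card1 card2 by (simp add: H card_Un_disjoint)
  then show ?thesis
    by (simp add: class_hooks_def ascents_def H_def A_def)
qed

lemma class_sum_two_sided:
  fixes x :: "'a::field_char_0"
  assumes r: "0 < r" "2 * r < t"
  defines "Q \<equiv> fps_X ^ (2 * t) :: 'a fps"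
  shows "class_sum t x M r = word_sum (fps_const x ^ 2)
     (\<lambda>j. if j < M then 1 else fps_X ^ (2 * r) * Q ^ (j - M))
     (\<lambda>j. if j < M then fps_X ^ (2 * (t - r)) * Q ^ (M - Suc j) else 1) (2 * M)"
proof -
  let ?x = "fps_const x"
  define f where "f k = t * k + r" for k
  define g where "g k = t * k + (t - r)" for k
  define C where "C = {n \<in> {0<..<t * M}. residue_class t (int n) = r}"
  \<comment> \<open>Along residue \<open>r\<close> the integers are \<open>f k\<close> to the right
    of 0 and \<open>- (g k)\<close> to the left. A negative integer is a bead when its absolute
    value is not a part, so on the left half occupation is complemented and the order
    reversed.\<close>
  define TT where "TT W = f ` {k. k < M \<and> M + k \<in> W} \<union> g ` {k. k < M \<and> M - Suc k \<notin> W}" for W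
  define WW where "WW T = {j. j < 2 * M \<and> (if j < M then g (M - Suc j) \<notin> T else f (j - M) \<in> T)}" for T
  have f_mod: "f k mod t = r" and g_mod: "g k mod t = t - r" for k
    unfolding f_def g_def mod_mult_self4 using r by simp_all
  have f_inj: "f k = f l \<longleftrightarrow> k = l" and g_inj: "g k = g l \<longleftrightarrow> k = l" for k l
    unfolding f_def g_def add_right_cancel using r by simp_all
  have fg: "f k \<noteq> g l" for k l
    using f_mod[of k] g_mod[of l] r by auto
  have f0: "f k > 0" and g0: "g k > 0" for k
    using r by (auto simp: f_def g_def)
  have lt: "f k < t * M \<longleftrightarrow> k < M" "g k < t * M \<longleftrightarrow> k < M" for k
  proof -
    have add_less: "t * k + s < t * M \<longleftrightarrow> k < M" if "0 < s" "s < t" for s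
    proof
      assume "t * k + s < t * M"
      then have "t * k < t * M" using that by linarith
      then show "k < M" by simp
    next
      assume "k < M"
      then have "t * Suc k \<le> t * M" by (intro mult_le_mono2) simp
      then show "t * k + s < t * M" using that by simp
    qed
    show "f k < t * M \<longleftrightarrow> k < M" "g k < t * M \<longleftrightarrow> k < M"
      unfolding f_def g_def by (rule add_less; use r in simp)+
  qed
  have cls: "residue_class t (int n) = r \<longleftrightarrow> n mod t = r \<or> n mod t = t - r" for n
    using residue_class_eq_iff[of r t "int n"] r unfolding of_nat_mod[symmetric] of_nat_eq_iff by simp
  have C_eq: "C = f ` {..<M} \<union> g ` {..<M}"
  proof (intro equalityI subsetI)
    fix n assume n: "n \<in> C"
    have "n = t * (n div t) + n mod t" by simp
    moreover have "n mod t = r \<or> n mod t = t - r"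
      using n cls unfolding C_def by blast
    ultimately have "n = f (n div t) \<or> n = g (n div t)"
      unfolding f_def g_def by metis
    with n lt show "n \<in> f ` {..<M} \<union> g ` {..<M}"
      by (fastforce simp: C_def)
  next
    fix n assume "n \<in> f ` {..<M} \<union> g ` {..<M}"
    then show "n \<in> C"
      using cls f_mod g_mod lt f0 g0 by (auto simp: C_def)
  qed
  have f_mem: "f k \<in> TT W \<longleftrightarrow> k < M \<and> M + k \<in> W"
    and g_mem: "g k \<in> TT W \<longleftrightarrow> k < M \<and> M - Suc k \<notin> W" for k W
    using f_inj g_inj fg fg[symmetric] by (auto simp: TT_def)
  have TT_sub: "TT W \<subseteq> C" for W
    by (auto simp: TT_def C_eq)
  have WT: "WW (TT W) = W" if "W \<subseteq> {..<2 * M}" for W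
    using that by (auto simp: WW_def f_mem g_mem split: if_splits)
  have TW: "TT (WW T) = T" if "T \<subseteq> C" for T
  proof -
    have "f k \<in> TT (WW T) \<longleftrightarrow> f k \<in> T" "g k \<in> TT (WW T) \<longleftrightarrow> g k \<in> T" if "k < M" for k
      using that by (auto simp: f_mem g_mem WW_def)
    then show ?thesis
      using \<open>T \<subseteq> C\<close> TT_sub[of "WW T"] unfolding C_eq by blast
  qed
  have hooks: "class_hooks t r (TT W) = 2 * ascents W" if W: "W \<subseteq> {..<2 * M}" for W
  proof (rule class_hooks_two_sided[OF r W])
    fix k :: int
    show "int t * k + int r \<in> maya (TT W) \<longleftrightarrow>
        k < - int M \<or> (k \<ge> - int M \<and> nat (k + int M) \<in> W)"
    proof (cases "k \<ge> 0")
      case True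
      then have "int t * k + int r = int (f (nat k))" by (simp add: f_def)
      moreover have "nat (k + int M) = M + nat k" using True by simp
      ultimately show ?thesis
        unfolding int_mem_maya[OF f0, of "nat k" "TT W", folded \<open>int t * k + int r = int (f (nat k))\<close>] f_mem
        using True W by auto
    next
      case False
      define l where "l = nat (- k - 1)"
      have k: "k = - int l - 1" using False by (simp add: l_def)
      have e: "int t * k + int r = - int (g l)"
        using r by (simp add: g_def k of_nat_diff algebra_simps)
      have "l < M \<Longrightarrow> nat (k + int M) = M - Suc l"
        by (simp add: k nat_diff_distrib' flip: of_nat_diff)
      then show ?thesis
        unfolding e minus_int_mem_maya[OF g0] g_mem using k by auto
    qed
  qed
  have ef: "fps_X ^ (2 * f k) = (fps_X ^ (2 * r) * Q ^ k :: 'a fps)"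
    and eg: "fps_X ^ (2 * g k) = (fps_X ^ (2 * (t - r)) * Q ^ k :: 'a fps)" for k
  proof -
    have "2 * f k = 2 * r + 2 * t * k" "2 * g k = 2 * (t - r) + 2 * t * k"
      by (simp_all add: f_def g_def)
    then show "fps_X ^ (2 * f k) = (fps_X ^ (2 * r) * Q ^ k :: 'a fps)"
      "fps_X ^ (2 * g k) = (fps_X ^ (2 * (t - r)) * Q ^ k :: 'a fps)"
      unfolding Q_def by (simp_all only: power_add power_mult)
  qed
  have weight: "fps_X ^ (2 * \<Sum>(TT W)) = (\<Prod>j<2 * M. if j \<in> W
      then (if j < M then 1 else fps_X ^ (2 * r) * Q ^ (j - M))
      else (if j < M then fps_X ^ (2 * (t - r)) * Q ^ (M - Suc j) else 1))" for W
  proof -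
    have injf: "inj_on f {..<M}" and injg: "inj_on g {..<M}"
      using f_inj g_inj by (auto simp: inj_on_def)
    have "(fps_X :: 'a fps) ^ (2 * \<Sum>(TT W)) = (\<Prod>n\<in>C. if n \<in> TT W then fps_X ^ (2 * n) else 1)"
      by (rule power_sum_eq_prod[OF _ TT_sub]) (simp add: C_eq)
    also have "\<dots> = (\<Prod>n\<in>f ` {..<M}. if n \<in> TT W then fps_X ^ (2 * n) else 1)
        * (\<Prod>n\<in>g ` {..<M}. if n \<in> TT W then fps_X ^ (2 * n) else 1)"
      unfolding C_eq by (rule prod.union_disjoint) (use fg in auto)
    also have "\<dots> = (\<Prod>k<M. if M + k \<in> W then fps_X ^ (2 * r) * Q ^ k else 1)
        * (\<Prod>k<M. if M - Suc k \<notin> W then fps_X ^ (2 * (t - r)) * Q ^ k else 1)"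
      unfolding prod.reindex[OF injf] prod.reindex[OF injg] o_def ef eg f_mem g_mem
      by (intro arg_cong2[of _ _ _ _ "(*)"] prod.cong) auto
    also have "(\<Prod>k<M. if M - Suc k \<notin> W then fps_X ^ (2 * (t - r)) * Q ^ k else 1)
        = (\<Prod>j<M. if M - Suc (M - Suc j) \<notin> W then fps_X ^ (2 * (t - r)) * Q ^ (M - Suc j) else 1)"
      by (rule prod.nat_diff_reindex[symmetric])
    also have "\<dots> = (\<Prod>j<M. if j \<in> W then 1 else fps_X ^ (2 * (t - r)) * Q ^ (M - Suc j))"
      by (intro prod.cong) auto
    finally show ?thesis
      unfolding mult_2[of M] prod_lessThan_add by (simp add: mult.commute cong: if_cong)
  qed
  have "class_sum t x M r = (\<Sum>T\<in>Pow C. ?x ^ class_hooks t r T * fps_X ^ (2 * \<Sum>T))"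
    by (simp add: class_sum_def C_def)
  also have "\<dots> = (\<Sum>W\<in>Pow {..<2 * M}. ?x ^ class_hooks t r (TT W) * fps_X ^ (2 * \<Sum>(TT W)))"
    by (rule sum.reindex_bij_witness[where i = TT and j = WW])
       (use TT_sub WT TW in \<open>auto simp: WW_def\<close>)
  also have "\<dots> = (\<Sum>W\<in>Pow {..<2 * M}. (?x ^ 2) ^ ascents W * fps_X ^ (2 * \<Sum>(TT W)))"
    by (rule sum.cong) (simp_all only: Pow_iff hooks power_mult)
  finally show ?thesis
    unfolding word_sum_def weight .
qed

section \<open>Products over the residue classes\<close>

text \<open>The factors are grouped by their exponent modulo \<open>t\<close>.\<close>

lemma qpoch_mult_length:
  "qpoch a q (n * t) = (\<Prod>j<t. qpoch (a * q ^ j) (q ^ t) n)"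
proof (induction n)
  case (Suc n)
  have "qpoch (a * q ^ (n * t)) q t = (\<Prod>j<t. 1 - a * q ^ j * (q ^ t) ^ n)"
    unfolding qpoch_def by (intro prod.cong refl) (simp add: power_mult mult_ac flip: power_mult)
  then have "qpoch a q (n * t + t) = (\<Prod>j<t. qpoch (a * q ^ j) (q ^ t) n * (1 - a * q ^ j * (q ^ t) ^ n))"
    unfolding qpoch_add Suc by (simp add: prod.distrib)
  then show ?case by (simp add: qpoch_Suc add.commute)
qed simp

lemma qpoch_inf_residues:
  fixes a q :: "'a::field_char_0 fps"
  assumes q: "q $ 0 = 0" and t: "t > 0"
  shows "(\<Prod>j<t. qpoch_inf (a * q ^ j) (q ^ t)) = qpoch_inf a q"
proof -
  have "(\<lambda>n. \<Prod>j<t. qpoch (a * q ^ j) (q ^ t) n) \<longlonglongrightarrow> (\<Prod>j<t. qpoch_inf (a * q ^ j) (q ^ t))"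
    using q t by (intro tendsto_prod_finite_fps qpoch_LIMSEQ) simp
  moreover have "(\<lambda>n. qpoch a q (n * t)) \<longlonglongrightarrow> qpoch_inf a q"
    using LIMSEQ_subseq_LIMSEQ[OF qpoch_LIMSEQ[OF q, of a], of "\<lambda>n. n * t"] t
    by (simp add: strict_mono_def o_def)
  ultimately show ?thesis
    unfolding qpoch_mult_length by (rule LIMSEQ_unique)
qed

lemma prod_residue_pairs:
  fixes c :: "nat \<Rightarrow> 'a::comm_monoid_mult"
  shows "(\<Prod>j\<in>{1..<t}. c j) =
    (\<Prod>r\<in>{1..(t - 1) div 2}. c r * c (t - r)) * (if even t \<and> t > 0 then c (t div 2) else 1)"
proof -
  let ?I = "{1..(t - 1) div 2}" and ?h = "if even t \<and> t > 0 then {t div 2} else {}"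
  have "{1..<t} = ?I \<union> ((\<lambda>r. t - r) ` ?I \<union> ?h)"
  proof (intro equalityI subsetI)
    fix j assume j: "j \<in> {1..<t}"
    consider "2 * j < t" | "2 * j = t" | "2 * j > t" by linarith
    then show "j \<in> ?I \<union> ((\<lambda>r. t - r) ` ?I \<union> ?h)"
    proof cases
      case 3
      then have "j = t - (t - j)" "t - j \<in> ?I" using j by auto
      then show ?thesis by blast
    qed (use j in auto)
  qed (auto split: if_splits)
  then have "prod c {1..<t} = prod c ?I * (prod c ((\<lambda>r. t - r) ` ?I) * prod c ?h)"
    by (simp only:, subst prod.union_disjoint; (subst prod.union_disjoint)?)
       (auto split: if_splits)
  also have "prod c ((\<lambda>r. t - r) ` ?I) = (\<Prod>r\<in>?I. c (t - r))"
    by (subst prod.reindex) (auto simp: inj_on_def)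
  also have "prod c ?h = (if even t \<and> t > 0 then c (t div 2) else 1)"
    by simp
  finally show ?thesis
    by (simp only: prod.distrib mult.assoc)
qed

lemma fps_const_one_minus_square:
  "1 - fps_const (1 - x ^ 2) = fps_const x ^ 2"
  "fps_const (1 - x ^ 2) = (1 - fps_const x) * (1 + fps_const x)"
  for x :: "'a::comm_ring_1"
  by (simp_all add: fps_eq_iff power2_eq_square algebra_simps flip: fps_const_1_eq_1)

lemma class_sum_0_LIMSEQ:
  fixes x :: "'a::field_char_0"
  assumes t: "t > 0" and x: "x \<noteq> - 1"
  shows "(\<lambda>M. class_sum t x M 0) \<longlonglongrightarrow>
    qpoch_inf (- (fps_X ^ (2 * t))) (fps_X ^ (2 * t)) * D_star x (fps_X ^ t)"
proof (rule LIMSEQ_offset[where k = 2])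
  let ?x = "fps_const x" and ?a = "fps_const (1 - x ^ 2)" and ?Q = "fps_X ^ (2 * t) :: 'a fps"
  have Q: "?Q $ 0 = 0" using t by simp
  have k: "fps_const (1 / (1 + x)) * (1 + ?x) = 1"
  proof -
    have "1 + x \<noteq> 0" using x by (metis add.commute add_eq_0_iff)
    then show ?thesis by (simp flip: fps_const_1_eq_1)
  qed
  have cls: "residue_class t (int n) = 0 \<longleftrightarrow> (\<exists>j. n = t * j + t)" if "n > 0" for n
  proof -
    have "residue_class t (int n) = 0 \<longleftrightarrow> t dvd n"
      using residue_class_eq_0_iff[OF t, of "int n"] by (simp flip: of_nat_mod add: dvd_eq_mod_eq_0)
    also have "\<dots> \<longleftrightarrow> (\<exists>j. n = t * j + t)"
    proof
      assume "t dvd n"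
      then obtain i where i: "n = t * i" by blast
      with that have "i > 0" by (auto intro: gr0I)
      with i have "n = t * (i - 1) + t" by (cases i) auto
      then show "\<exists>j. n = t * j + t" by blast
    qed auto
    finally show ?thesis .
  qed
  have lt: "t * j + t < t * (n + 2) \<longleftrightarrow> j < Suc n" for j n
  proof -
    have "t * j + t < t * (n + 2) \<longleftrightarrow> t * Suc j < t * (n + 2)" by (simp add: add.commute)
    also have "\<dots> \<longleftrightarrow> j < Suc n" using t by (subst mult_less_cancel1) auto
    finally show ?thesis .
  qed
  \<comment> \<open>The positive multiples of \<open>t\<close> below \<open>t * (n + 2)\<close>
    number \<open>n + 1\<close>, which explains the offset 2; a word of positive length is needed
    for a first position to exist.\<close>
  have cs: "class_sum t x (n + 2) 0 = word_sum (1 - ?a)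
      (\<lambda>j. if j = 0 then ?x * ?Q else ?Q * ?Q ^ j) (\<lambda>_. 1) (Suc n)" for n
    unfolding fps_const_one_minus_square(1)
    by (rule class_sum_one_sided[OF t disjI1[OF refl]]) (simp_all only: cls lt)
  have "(\<lambda>n. fps_const (1 / (1 + x)) * ((1 + ?x) * class_sum t x (n + 2) 0)) \<longlonglongrightarrow>
    fps_const (1 / (1 + x)) * (qpoch_inf (- ?Q) ?Q *
      (qpoch_inf (?a * ?Q) (?Q ^ 2) + ?x * qpoch_inf (?a * ?Q ^ 2) (?Q ^ 2)))"
    unfolding cs
    by (intro tendsto_mult_fps tendsto_const word_sum_integers_LIMSEQ Q fps_const_one_minus_square)
  then have lim: "(\<lambda>n. class_sum t x (n + 2) 0) \<longlonglongrightarrow>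
    fps_const (1 / (1 + x)) * (qpoch_inf (- ?Q) ?Q *
      (qpoch_inf (?a * ?Q) (?Q ^ 2) + ?x * qpoch_inf (?a * ?Q ^ 2) (?Q ^ 2)))"
    unfolding mult.assoc[symmetric] k by (simp add: mult.assoc)
  have e: "(fps_X ^ t) ^ 2 = ?Q" "(fps_X ^ t) ^ 4 = ?Q ^ 2"
    by (simp_all flip: power_mult add: mult.commute)
  show "(\<lambda>n. class_sum t x (n + 2) 0) \<longlonglongrightarrow> qpoch_inf (- ?Q) ?Q * D_star x (fps_X ^ t)"
    using lim unfolding D_star_def e by (simp only: mult_ac)
qed

lemma class_sum_half_LIMSEQ:
  fixes x :: "'a::field_char_0"
  assumes h: "h > 0" and x: "x \<noteq> - 1" "x \<noteq> 0" and rs: "compatible_roots x r s"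
  defines "p \<equiv> fps_X ^ (2 * h) :: 'a fps"
  shows "(\<lambda>M. class_sum (2 * h) x M h) \<longlonglongrightarrow> qpoch_inf (- p) (p ^ 2) * H_star x r s p"
proof (rule LIMSEQ_offset[where k = 1])
  let ?x = "fps_const x" and ?c = "fps_const s"
  have p: "p $ 0 = 0" "(- p) $ 0 = 0" using h by (simp_all add: p_def)
  have x1: "1 + x \<noteq> 0" using x by (metis add.commute add_eq_0_iff)
  have s2: "s ^ 2 = 1 - x ^ 2" and sr: "s = (1 + x) * r"
    using rs by (auto simp: compatible_roots_def)
  have c: "?c ^ 2 = fps_const (1 - x ^ 2)" by (simp add: s2)
  have cls: "residue_class (2 * h) (int n) = h \<longleftrightarrow> (\<exists>j. n = 2 * h * j + h)" for n
  proof -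
    have "residue_class (2 * h) (int n) = h \<longleftrightarrow> int n mod int (2 * h) = int h"
      using residue_class_eq_iff[of h "2 * h" "int n"] h by simp
    also have "\<dots> \<longleftrightarrow> n mod (2 * h) = h"
      unfolding of_nat_mod[symmetric] of_nat_eq_iff ..
    also have "\<dots> \<longleftrightarrow> (\<exists>j. n = 2 * h * j + h)"
    proof
      assume "n mod (2 * h) = h"
      then have "n = 2 * h * (n div (2 * h)) + h"
        using mult_div_mod_eq[of "2 * h" n] by simp
      then show "\<exists>j. n = 2 * h * j + h" by blast
    next
      assume "\<exists>j. n = 2 * h * j + h"
      then obtain j where "n = 2 * h * j + h" by blast
      then show "n mod (2 * h) = h"
        using h by (simp only: mod_mult_self4) simp
    qed
    finally show ?thesis .
  qed
  have lt: "2 * h * j + h < 2 * h * (n + 1) \<longleftrightarrow> j < Suc n" for j n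
  proof
    assume "2 * h * j + h < 2 * h * (n + 1)"
    then have "2 * h * j < 2 * h * (n + 1)" by linarith
    then show "j < Suc n" by (simp only: mult_less_cancel1) simp
  next
    assume "j < Suc n"
    then have "2 * h * j \<le> 2 * h * n" by (intro mult_le_mono2) simp
    moreover have "2 * h * (n + 1) = 2 * h * n + 2 * h" by simp
    ultimately show "2 * h * j + h < 2 * h * (n + 1)" using h by linarith
  qed
  have X: "fps_X ^ (2 * (2 * h)) = p ^ 2"
    by (simp add: p_def flip: power_mult)
  have cs: "class_sum (2 * h) x (n + 1) h = word_sum (1 - ?c ^ 2)
      (\<lambda>j. if j = 0 then ?x * p else p * (p ^ 2) ^ j) (\<lambda>_. 1) (Suc n)" for n
    unfolding c fps_const_one_minus_square(1) X[symmetric] unfolding p_def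
    by (rule class_sum_one_sided[OF _ disjI2[OF refl] cls lt]) (use h in simp)
  define k where "k = fps_const (1 / (2 * (1 + x)))"
  have k: "k * 2 * (1 + ?x) = 1"
  proof -
    have "1 / (2 * y) * 2 * y = 1" if "y \<noteq> 0" for y :: 'a
      using that by simp
    from this[OF x1] have "fps_const (1 / (2 * (1 + x))) * fps_const 2 * fps_const (1 + x) = 1"
      by (simp only: fps_const_mult fps_const_1_eq_1)
    then show ?thesis
      by (simp only: k_def numeral_fps_const fps_const_add[symmetric] fps_const_1_eq_1)
  qed
  define U V where "U = qpoch_inf (?c * p) (- p)" and "V = qpoch_inf (- (?c * p)) (- p)"
  have U: "qpoch_inf (fps_const (- s)) (- p) = (1 + ?c) * U"
    using qpoch_inf_split[OF p(2), of "- ?c" 1] unfolding fps_const_neg[symmetric]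
    by (simp add: U_def qpoch_def del: fps_const_neg)
  have V: "qpoch_inf ?c (- p) = (1 - ?c) * V"
    using qpoch_inf_split[OF p(2), of ?c 1] by (simp add: V_def qpoch_def)
  have "(\<lambda>n. k * (2 * ((1 + ?x) * class_sum (2 * h) x (n + 1) h))) \<longlonglongrightarrow>
    k * (qpoch_inf (- p) (p ^ 2) * ((1 + ?c + ?x) * U + (1 - ?c + ?x) * V))"
    unfolding cs U_def V_def
    by (intro tendsto_mult_fps tendsto_const word_sum_half_integers_LIMSEQ p)
       (simp only: c fps_const_one_minus_square(2))
  then have lim: "(\<lambda>n. class_sum (2 * h) x (n + 1) h) \<longlonglongrightarrow>
    k * (qpoch_inf (- p) (p ^ 2) * ((1 + ?c + ?x) * U + (1 - ?c + ?x) * V))"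
    unfolding mult.assoc[symmetric] k by (simp add: mult.assoc)
  have frac: "u / (2 * x) = v / (2 * (1 + x))" if "u * (1 + x) = x * v" for u v
  proof -
    have "u * (2 * (1 + x)) = 2 * (u * (1 + x))"
      by (simp only: mult_ac)
    also have "\<dots> = v * (2 * x)"
      unfolding that by (simp only: mult_ac)
    finally have "u * (2 * (1 + x)) = v * (2 * x)" .
    moreover have "2 * (1 + x) \<noteq> 0" "2 * x \<noteq> 0"
      using x1 x(2) by (simp_all only: mult_eq_0_iff zero_neq_numeral[symmetric] simp_thms)
    ultimately show ?thesis
      by (intro iffD2[OF frac_eq_eq])
  qed
  \<comment> \<open>Compatibility replaces \<open>(1 + x) * r\<close> by \<open>s\<close>, and the
    remainder \<open>1 - x ^ 2 - s ^ 2\<close> vanishes. What is left is divisible by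
    \<open>x\<close>, matching the denominator \<open>2 * x\<close> of \<open>H_star\<close> with
    the denominator \<open>2 * (1 + x)\<close> of the limit.\<close>
  have "(1 - r) * (1 + s) * (1 + x) = (1 + s) * (1 + x - s)"
    "(1 + r) * (1 - s) * (1 + x) = (1 - s) * (1 + x + s)"
    unfolding sr by (simp_all add: algebra_simps)
  moreover have "(1 + s) * (1 + x - s) = x * (1 + s + x) + (1 - x ^ 2 - s ^ 2)"
    "(1 - s) * (1 + x + s) = x * (1 - s + x) + (1 - x ^ 2 - s ^ 2)"
    by (simp_all add: power2_eq_square algebra_simps)
  ultimately have key: "(1 - r) * (1 + s) / (2 * x) = (1 + s + x) / (2 * (1 + x))"
    "(1 + r) * (1 - s) / (2 * x) = (1 - s + x) / (2 * (1 + x))"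
    unfolding s2 by (intro frac; simp)+
  note const = fps_const_mult fps_const_add fps_const_sub fps_const_1_eq_1[symmetric]
  have keyU: "fps_const (1 / (2 * x)) * fps_const (1 - r) * (1 + ?c) = k * (1 + ?c + ?x)"
    and keyV: "fps_const (1 / (2 * x)) * fps_const (1 + r) * (1 - ?c) = k * (1 - ?c + ?x)"
    using key unfolding k_def const by (simp_all add: mult_ac)
  have "k * (qpoch_inf (- p) (p ^ 2) * ((1 + ?c + ?x) * U + (1 - ?c + ?x) * V))
      = qpoch_inf (- p) (p ^ 2) * ((k * (1 + ?c + ?x)) * U + (k * (1 - ?c + ?x)) * V)"
    by (simp add: algebra_simps)
  also have "\<dots> = qpoch_inf (- p) (p ^ 2) * H_star x r s p"
    unfolding H_star_def U V keyU[symmetric] keyV[symmetric] by (simp only: ring_distribs mult_ac)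
  finally show "(\<lambda>n. class_sum (2 * h) x (n + 1) h) \<longlonglongrightarrow> qpoch_inf (- p) (p ^ 2) * H_star x r s p"
    using lim by (simp only:)
qed

lemma class_sum_pair_LIMSEQ:
  fixes x :: "'a::field_char_0"
  assumes r: "0 < r" "2 * r < t"
  defines "Q \<equiv> fps_X ^ (2 * t) :: 'a fps"
  shows "(\<lambda>M. class_sum t x M r) \<longlonglongrightarrow> qpoch_inf (fps_const (1 - x ^ 2) * Q) Q *
    (qpoch_inf (- (fps_X ^ (2 * (t - r)))) Q * qpoch_inf (- (fps_X ^ (2 * r))) Q)"
proof -
  have "2 * r + 2 * (t - r) = 2 * t" using r by simp
  then have "fps_X ^ (2 * r) * fps_X ^ (2 * (t - r)) = Q"
    by (simp add: Q_def flip: power_add)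
  moreover have "Q $ 0 = 0" "Q \<noteq> 0"
    using r by (simp_all add: Q_def)
  ultimately show ?thesis
    unfolding class_sum_two_sided[OF r] Q_def[symmetric] fps_const_one_minus_square(1)[symmetric]
    by (intro word_sum_bilateral_LIMSEQ) auto
qed

theorem theorem1p1:
  fixes t :: nat and x :: "'a::field_char_0"
  assumes "t \<ge> 1" and "x \<noteq> -1"
  shows "(odd t \<longrightarrow>
           F_series t x =
             qpoch_inf (- (fps_X^2)) (fps_X^2)
             * qpoch_inf (fps_const (1 - x^2) * fps_X^(2*t)) (fps_X^(2*t)) ^ ((t - 1) div 2)
             * D_star x (fps_X^t)) \<and>
         (even t \<longrightarrow> x \<noteq> 0 \<longrightarrow>
           (\<forall>r s. compatible_roots x r s \<longrightarrow>
             F_series t x =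
               qpoch_inf (- (fps_X^2)) (fps_X^2)
               * qpoch_inf (fps_const (1 - x^2) * fps_X^(2*t)) (fps_X^(2*t)) ^ ((t - 2) div 2)
               * D_star x (fps_X^t) * H_star x r s (fps_X^t)))"
proof -
  have t: "t > 0" using assms(1) by simp
  define Q :: "'a fps" where "Q = fps_X ^ (2 * t)"
  define c where "c j = qpoch_inf (- (fps_X ^ (2 * j))) Q" for j
  define P where "P = qpoch_inf (fps_const (1 - x ^ 2) * Q) Q"
  let ?D = "D_star x (fps_X ^ t)" and ?I = "{1..(t - 1) div 2}"
  \<comment> \<open>\<open>Z\<close> stands for the additional factor of the class of
    \<open>t / 2\<close>: \<open>H_star\<close> for even \<open>t\<close>. For odd \<open>t\<close>
    that branch is never reached and \<open>Z = 1\<close> serves as a dummy.\<close>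
  define L where "L Z r = (if r = 0 then c t * ?D else if 2 * r < t then P * (c (t - r) * c r)
    else c r * Z)" for Z r
  have L0: "(\<lambda>M. class_sum t x M 0) \<longlonglongrightarrow> L Z 0" for Z
    using class_sum_0_LIMSEQ[OF t assms(2)] by (simp add: L_def c_def Q_def)
  have L1: "(\<lambda>M. class_sum t x M r) \<longlonglongrightarrow> L Z r" if "0 < r" "2 * r < t" for r Z
    using class_sum_pair_LIMSEQ[OF that, of x] that by (simp add: L_def c_def Q_def P_def)
  have F: "F_series t x = (\<Prod>r\<le>t div 2. L Z r)"
    if "\<And>r. r \<le> t div 2 \<Longrightarrow> (\<lambda>M. class_sum t x M r) \<longlonglongrightarrow> L Z r" for Z
    by (rule LIMSEQ_unique[OF F_series_LIMSEQ[OF t]], rule tendsto_prod_finite_fps) (simp only: that atMost_iff)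
  have L_0: "L Z 0 = c t * ?D" for Z
    by (simp add: L_def)
  have L_prod: "(\<Prod>r\<le>t div 2. L Z r)
      = qpoch_inf (- (fps_X ^ 2)) (fps_X ^ 2) * P ^ ((t - 1) div 2) * ?D * (if even t then Z else 1)" for Z
  proof -
    let ?h = "if even t then {t div 2} else {}"
    have "{..t div 2} = insert 0 (?I \<union> ?h)"
      using t by (cases "even t") (auto elim!: evenE oddE)
    then have "(\<Prod>r\<le>t div 2. L Z r) = L Z 0 * ((\<Prod>r\<in>?I. L Z r) * (\<Prod>r\<in>?h. L Z r))"
      using t by (subst prod.union_disjoint[symmetric]) auto
    also have "(\<Prod>r\<in>?I. L Z r) = (\<Prod>r\<in>?I. P * (c r * c (t - r)))"
      by (intro prod.cong) (auto simp: L_def mult_ac)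
    also have "\<dots> = P ^ ((t - 1) div 2) * (\<Prod>r\<in>?I. c r * c (t - r))"
      by (simp add: prod.distrib)
    also have "(\<Prod>r\<in>?h. L Z r) = (if even t \<and> t > 0 then c (t div 2) else 1) * (if even t then Z else 1)"
      using t by (auto simp: L_def)
    also have "L Z 0 * (P ^ ((t - 1) div 2) * (\<Prod>r\<in>?I. c r * c (t - r)) *
          ((if even t \<and> t > 0 then c (t div 2) else 1) * (if even t then Z else 1)))
        = (c t * (\<Prod>j\<in>{1..<t}. c j)) * P ^ ((t - 1) div 2) * ?D * (if even t then Z else 1)"
      unfolding prod_residue_pairs L_0 by (simp only: mult_ac)
    \<comment> \<open>The factor \<open>c t\<close> from the class of 0 completes the product to
      \<open>j = 1, ..., t\<close>, a full system of residues.\<close>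
    also have "c t * (\<Prod>j\<in>{1..<t}. c j) = (\<Prod>j\<in>{1..<Suc t}. c j)"
      using t by (simp add: mult.commute)
    also have "\<dots> = (\<Prod>j<t. c (Suc j))"
      unfolding lessThan_atLeast0 One_nat_def prod.shift_bounds_Suc_ivl ..
    also have "\<dots> = (\<Prod>j<t. qpoch_inf (- (fps_X ^ 2) * (fps_X ^ 2) ^ j) ((fps_X ^ 2) ^ t))"
      by (simp only: c_def Q_def power_mult power_Suc mult_minus_left)
    also have "\<dots> = qpoch_inf (- (fps_X ^ 2)) (fps_X ^ 2)"
      using t by (intro qpoch_inf_residues) auto
    finally show ?thesis .
  qed
  show ?thesis
  proof (intro conjI impI allI)
    assume "odd t"
    have "(\<lambda>M. class_sum t x M r) \<longlonglongrightarrow> L 1 r" if "r \<le> t div 2" for r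
    proof (cases "r = 0")
      case False
      moreover have "2 * r < t"
        using \<open>odd t\<close> that by presburger
      ultimately show ?thesis by (intro L1) simp_all
    qed (simp only: L0)
    from F[OF this] show "F_series t x = qpoch_inf (- (fps_X^2)) (fps_X^2)
        * qpoch_inf (fps_const (1 - x^2) * fps_X^(2*t)) (fps_X^(2*t)) ^ ((t - 1) div 2) * ?D"
      using \<open>odd t\<close> by (simp only: L_prod P_def Q_def if_False mult_1_right)
  next
    fix r s assume "even t" "x \<noteq> 0" and rs: "compatible_roots x r s"
    let ?H = "H_star x r s (fps_X ^ t)"
    obtain h where h: "t = 2 * h" using \<open>even t\<close> by blast
    have "(\<lambda>M. class_sum t x M h) \<longlonglongrightarrow> L ?H h"
    proof -
      have "(fps_X ^ (2 * h)) ^ 2 = Q"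
        unfolding Q_def h by (simp flip: power_mult add: mult_ac)
      then show ?thesis
        using class_sum_half_LIMSEQ[OF _ assms(2) \<open>x \<noteq> 0\<close> rs, of h] t
        by (simp add: L_def c_def h)
    qed
    then have "(\<lambda>M. class_sum t x M i) \<longlonglongrightarrow> L ?H i" if i: "i \<le> t div 2" for i
    proof -
      have "i = 0 \<or> i = h \<or> 0 < i \<and> 2 * i < t"
        using i h by auto
      then consider "i = 0" | "i = h" | "0 < i" "2 * i < t"
        by blast
      then show ?thesis
      proof cases
        case 1
        then show ?thesis by (simp only: L0)
      next
        case 2
        then show ?thesis using \<open>(\<lambda>M. class_sum t x M h) \<longlonglongrightarrow> L ?H h\<close> by (simp only:)
      next
        case 3
        then show ?thesis by (rule L1)
      qed
    qed
    moreover have "(t - 1) div 2 = (t - 2) div 2"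
      using h t by (cases h) auto
    ultimately have "F_series t x = (\<Prod>i\<le>t div 2. L ?H i)"
      by (intro F)
    then show "F_series t x = qpoch_inf (- (fps_X^2)) (fps_X^2)
        * qpoch_inf (fps_const (1 - x^2) * fps_X^(2*t)) (fps_X^(2*t)) ^ ((t - 2) div 2) * ?D * ?H"
      using \<open>even t\<close> \<open>(t - 1) div 2 = (t - 2) div 2\<close> by (simp only: L_prod P_def Q_def if_True)
  qed
qed

end
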